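(* Let $X,Y$ be Hilbert spaces, $0\neq K\in\mathcal L(X;Y)$, and let $G:X\to(-\infty,\infty]$, $F^*:Y\to(-\infty,\infty]$ be convex, proper and lower semicontinuous. Let $P\in\mathcal L(X;X)$ be an orthogonal projection ($P^2=P=P^*$), $P^\perp:=I-P$. Suppose that for some scalars $\bar\gamma,\bar\gamma^\perp,\bar\rho>0$ and constants $C_\phi,C_\psi^\perp>0$, $$G(x')-G(x)\ge\langle\partial G(x),x'-x\rangle+\frac{\bar\gamma}2\|P(x'-x)\|^2+\frac{\gamma^\perp}2\left(\|P^\perp(x'-x)\|^2-C_\psi^\perp\right)\quad(x,x'\in X;\ 0\le\gamma^\perp\le\bar\gamma^\perp),$$ $$F^*(y')-F^*(y)\ge\langle\partial F^*(y),y'-y\rangle+\frac\rho2\left(\|y'-y\|^2-C_\phi\right)\quad(y,y'\in Y;\ 0\le\rho\le\bar\rho).$$ Let $\hat u=(\hat x,\hat y)$ satisfy $-K^*\hat y\in\partial G(\hat x)$ and $K\hat x\in\partial F^*(\hat y)$. Let $\lambda=1/2$, and fix $\gamma\in(0,\lambda\bar\gamma]$, $\tau_0,\tau_0^\perp>0$, $\delta\in(0,1)$ and $0<\zeta\le(\tau_0^\perp)^{-2}$ such that $$0<\tau_0\le\frac{\lambda^2}{2\gamma}\min\left\{\frac{(\bar\gamma^\perp)^2}{\zeta},\ \frac{\bar\rho^2\zeta(1-\delta)^2}{\|K\|^4}\right\}.$$ Let $(x^0,y^0)\in X\times Y$ and let $(x^i,y^i)$, $i\ge 1$, be generated by the algorithm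 described in the context. Then there are constants $C_0,C_\tau>0$, independent of $N$, such that for all $N\ge1$ $$\frac\delta2\|P(x^N-\hat x)\|^2+\frac1{\tau_0^{-1}+2\gamma}\mathcal G^N\ \le\ \frac{C_0C_\tau^2}{N^2}+\frac{C_\tau}{2N}\left(\zeta^{1/2}C_\psi^\perp+\frac{\zeta^{-1/2}\|K\|^2}{1-\delta}C_\phi\right),$$ where $\mathcal G^N$ is the ergodic duality gap defined in the context. If instead $\lambda=1$ is taken (in the conditions on $\gamma$ and $\tau_0$), then the same estimate holds with $\mathcal G^N$ replaced by $0$.
   Context: Hilbert spaces are real. $\partial$ is the convex subdifferential; inequalities containing $\partial G(x)$, $\partial F^*(y)$ are required for every element of that set (vacuous when empty). Algorithm: for $i=0,1,2,\dots$ set $$\omega_i=\frac1{\sqrt{1+2\gamma\tau_i}},\qquad \omega_i^\perp=\frac12\left((1-\zeta^{-1}(\tau_i^\perp)^{-2})\,\omega_i+\sqrt{(1-\zeta^{-1}(\tau_i^\perp)^{-2})^2\omega_i^2+4\zeta^{-1}(\tau_i^\perp)^{-2}}\right),$$ $$\tau_{i+1}=\tau_i\omega_i,\qquad \tau_{i+1}^\perp=\tau_i^\perp\omega_i^\perp,\qquad \sigma_{i+1}=\frac{\omega_i^{-1}(1-\delta)}{\max\{0,\tau_i-\tau_i^\perp\}\|KP\|^2+\tau_i^\perp\|K\|^2},$$ and with $T_i=\tau_iP+\tau_i^\perp P^\perp$ update $$x^{i+1}=(I+T_i\partial G)^{-1}(x^i-T_iK^*y^i),\quad \bar x^{i+1}=\omega_i(x^{i+1}-x^i)+x^{i+1},\quad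 y^{i+1}=(I+\sigma_{i+1}\partial F^* )^{-1}(y^i+\sigma_{i+1}K\bar x^{i+1}).$$ Ergodic duality gap: let $\tilde\tau_0>0$ be arbitrary and $\tilde\tau_{i+1}=\tilde\tau_i\omega_i$ (the averages below do not depend on $\tilde\tau_0$; one may take $\tilde\tau_i=\tau_i$). Put $\tilde q_N=\sum_{j=0}^{N-1}\tilde\tau_j^{-1}$, $\hat q_N=\sum_{j=0}^{N-1}\tilde\tau_{j+1}^{-1}$, $$x_N=\tilde q_N^{-1}\sum_{i=0}^{N-1}\tilde\tau_i^{-1}x^{i+1},\qquad y_N=\hat q_N^{-1}\sum_{i=0}^{N-1}\tilde\tau_{i+1}^{-1}y^{i+1},$$ $$\mathcal G^N=\bigl(G(x_N)+\langle\hat y,Kx_N\rangle-F^*(\hat y)\bigr)-\bigl(G(\hat x)+\langle y_N,K\hat x\rangle-F^*(y_N)\bigr).$$ *)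

theory Defs
  imports "HOL-Analysis.Analysis"
begin

definition proper_fun :: "('a \<Rightarrow> ereal) \<Rightarrow> bool" where
  "proper_fun f \<longleftrightarrow> (\<forall>x. f x \<noteq> -\<infinity>) \<and> (\<exists>x. f x \<noteq> \<infinity>)"

(* The library's convex_on only covers real-valued functions. For proper f no term of the form
   \<infinity> - \<infinity> arises here, and 0 * \<infinity> = 0 in ereal makes the cases u = 0 and v = 0 harmless. *)
definition convex_fun :: "('a::real_vector \<Rightarrow> ereal) \<Rightarrow> bool" where
  "convex_fun f \<longleftrightarrow>
    (\<forall>x y. \<forall>u\<ge>0. \<forall>v\<ge>0. u + v = 1 \<longrightarrow> f (u *\<^sub>R x + v *\<^sub>R y) \<le> ereal u * f x + ereal v * f y)"

definition lsc_fun :: "('a::topological_space \<Rightarrow> ereal) \<Rightarrow> bool" where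
  "lsc_fun f \<longleftrightarrow> (\<forall>x. f x \<le> Liminf (at x) f)"

(* For proper f this is empty at every x with f x = \<infinity>. *)
definition subdifferential :: "('a::real_inner \<Rightarrow> ereal) \<Rightarrow> 'a \<Rightarrow> 'a set" where
  "subdifferential f x = {p. \<forall>x'. f x + ereal (p \<bullet> (x' - x)) \<le> f x'}"

(* (I + T A)^{-1}(z) as the inverse of a set-valued map. *)
definition resolvent :: "('a::real_normed_vector \<Rightarrow>\<^sub>L 'a) \<Rightarrow> ('a \<Rightarrow> 'a set) \<Rightarrow> 'a \<Rightarrow> 'a set" where
  "resolvent T A z = {x. \<exists>p\<in>A x. z = x + T p}"

(* w, wp, t, tp, s stand for \<omega>, \<omega>^\<perp>, \<tau>, \<tau>^\<perp>, \<sigma>; the value s 0 is never used. The resolvents of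
   subdifferentials below are at most single-valued, so membership is the update equation. *)
definition pdhgm_iteration ::
  "('a::real_inner \<Rightarrow>\<^sub>L 'b::real_inner) \<Rightarrow> ('a \<Rightarrow>\<^sub>L 'a) \<Rightarrow> ('a \<Rightarrow> ereal) \<Rightarrow> ('b \<Rightarrow> ereal) \<Rightarrow>
   real \<Rightarrow> real \<Rightarrow> real \<Rightarrow> (nat \<Rightarrow> real) \<Rightarrow> (nat \<Rightarrow> real) \<Rightarrow> (nat \<Rightarrow> real) \<Rightarrow> (nat \<Rightarrow> real) \<Rightarrow> (nat \<Rightarrow> real) \<Rightarrow>
   (nat \<Rightarrow> 'a) \<Rightarrow> (nat \<Rightarrow> 'b) \<Rightarrow> bool" where
  "pdhgm_iteration K P G Fs \<gamma> \<delta> \<zeta> w wp t tp s x y \<longleftrightarrow> (\<forall>i.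
     w i = 1 / sqrt (1 + 2 * \<gamma> * t i) \<and>
     wp i = 1/2 * ((1 - 1 / (\<zeta> * (tp i)\<^sup>2)) * w i
              + sqrt ((1 - 1 / (\<zeta> * (tp i)\<^sup>2))\<^sup>2 * (w i)\<^sup>2 + 4 / (\<zeta> * (tp i)\<^sup>2))) \<and>
     t (Suc i) = t i * w i \<and>
     tp (Suc i) = tp i * wp i \<and>
     s (Suc i) = (1 / w i) * (1 - \<delta>)
              / (max 0 (t i - tp i) * (norm (K o\<^sub>L P))\<^sup>2 + tp i * (norm K)\<^sup>2) \<and>
     (let T = t i *\<^sub>R P + tp i *\<^sub>R (id_blinfun - P);
          xbar = w i *\<^sub>R (x (Suc i) - x i) + x (Suc i)
      in x (Suc i) \<in> resolvent T (subdifferential G) (x i - T (adjoint (blinfun_apply K) (y i))) \<and>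
         y (Suc i) \<in> resolvent (s (Suc i) *\<^sub>R id_blinfun) (subdifferential Fs)
                        (y i + s (Suc i) *\<^sub>R K xbar)))"

(* The weights tt stand for the sequence written with a tilde over \<tau>. *)
definition ergodic_x :: "(nat \<Rightarrow> real) \<Rightarrow> (nat \<Rightarrow> 'a::real_vector) \<Rightarrow> nat \<Rightarrow> 'a" where
  "ergodic_x tt x N = (1 / (\<Sum>j<N. 1 / tt j)) *\<^sub>R (\<Sum>i<N. (1 / tt i) *\<^sub>R x (Suc i))"

definition ergodic_y :: "(nat \<Rightarrow> real) \<Rightarrow> (nat \<Rightarrow> 'b::real_vector) \<Rightarrow> nat \<Rightarrow> 'b" where
  "ergodic_y tt y N = (1 / (\<Sum>j<N. 1 / tt (Suc j))) *\<^sub>R (\<Sum>i<N. (1 / tt (Suc i)) *\<^sub>R y (Suc i))"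

definition ergodic_gap ::
  "('a::real_inner \<Rightarrow>\<^sub>L 'b::real_inner) \<Rightarrow> ('a \<Rightarrow> ereal) \<Rightarrow> ('b \<Rightarrow> ereal) \<Rightarrow> 'a \<Rightarrow> 'b \<Rightarrow>
   (nat \<Rightarrow> real) \<Rightarrow> (nat \<Rightarrow> 'a) \<Rightarrow> (nat \<Rightarrow> 'b) \<Rightarrow> nat \<Rightarrow> ereal" where
  "ergodic_gap K G Fs xh yh tt x y N =
     (G (ergodic_x tt x N) + ereal (yh \<bullet> K (ergodic_x tt x N)) - Fs yh)
     - (G xh + ereal (ergodic_y tt y N \<bullet> K xh) - Fs (ergodic_y tt y N))"

end

theory Submission
  imports Defs
begin

text \<open>
  Write \<open>u i = x i - xh\<close>, \<open>v i = y i - yh\<close>, \<open>Q = I - P\<close> and \<open>r i = tp i / t i\<close>. Test the primal optimality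
  condition with \<open>u (i+1) / t i\<close> and the dual one with \<open>v (i+1) / t (i+1)\<close>. The coupling terms telescope, and
  the energy
  \<open>(|P u|^2 / t^2 + |Q u|^2 / (t tp) + load r |v|^2 / (1 - \<delta>)) / 2 - <K u, v> / t\<close>
  appears, where \<open>load r = max 0 (1 - r) |K P|^2 + r |K|^2\<close>. It dominates \<open>\<delta> |P u|^2 / (2 t^2)\<close> by Young's inequality.
  The growth of its coefficients from one step to the next is paid by the three growth moduli: the rule
  for w gives \<open>1 / t'^2 = 1 / t^2 + 2 \<gamma> / t\<close>, which consumes strong convexity along P, while the rule for wp makes
  \<open>1 / (t tp) - \<zeta> r\<close> constant and load r has slope at most \<open>|K|^2\<close>. Hence the penalties for \<open>Cpsi\<close> and
  \<open>Cphi\<close> are both proportional to the increments of r and sum up to a multiple of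
  \<open>r N \<le> 1 / (sqrt \<zeta> t N)\<close>. Multiplication by \<open>(t N)^2\<close> and \<open>t N = O(1/N)\<close> give the rates. With \<open>lam = 1/2\<close> one
  half of the growth is kept for the gap, which then enters by Jensen's inequality; with \<open>lam = 1\<close> the
  subgradient inequalities at the iterate and at the solution are added instead.
\<close>

subsection \<open>Hilbert space adjoints and convex functions\<close>

lemma riesz_representation:
  fixes f :: "'a::{real_inner, complete_space} \<Rightarrow> real"
  assumes f: "bounded_linear f"
  shows "\<exists>z. \<forall>x. f x = x \<bullet> z"
proof -
  \<comment> \<open>The representer minimises J over the space; the parallelogram law makes minimising sequences Cauchy.\<close>
  interpret bounded_linear f by (fact f)
  define J where "J x = x \<bullet> x - 2 * f x" for x
  obtain B where B: "\<And>x. norm (f x) \<le> norm x * B"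
    using bounded by blast
  \<comment> \<open>Completing the square: \<open>J x\<close> is at least |x|^2 - 2 B |x| = (|x| -
    B)^2 - B^2.\<close>
  have below: "- B\<^sup>2 \<le> J x" for x
  proof -
    have "f x \<le> norm x * B" using B[of x] by simp
    moreover have "0 \<le> (norm x - B)\<^sup>2" by simp
    ultimately show ?thesis
      unfolding J_def by (simp add: power2_norm_eq_inner[symmetric] power2_eq_square algebra_simps)
  qed
  have bdd: "bdd_below (range J)" using below by (auto intro: bdd_belowI[where m = "- B\<^sup>2"])
  define m where "m = Inf (range J)"
  have m_le: "m \<le> J x" for x
    unfolding m_def using bdd by (simp add: cInf_lower)
  define \<epsilon> where "\<epsilon> n = 1 / real (Suc n)" for n
  have "\<exists>x. J x < m + \<epsilon> n" for n
  proof (rule ccontr)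
    assume "\<not> ?thesis"
    then have "m + \<epsilon> n \<le> Inf (range J)"
      by (intro cInf_greatest) (auto simp: not_less)
    then show False unfolding m_def \<epsilon>_def by simp
  qed
  then obtain X where X: "\<And>n. J (X n) < m + \<epsilon> n" by metis
  have close: "(norm (a - b))\<^sup>2 \<le> 2 * (J a - m) + 2 * (J b - m)" for a b
  proof -
    have "(norm (a - b))\<^sup>2 = 2 * J a + 2 * J b - 4 * J ((1/2) *\<^sub>R (a + b))"
      unfolding J_def power2_norm_eq_inner
      by (simp add: inner_add inner_diff inner_commute add scale scaleR_add_right algebra_simps)
    then show ?thesis using m_le[of "(1/2) *\<^sub>R (a + b)"] by simp
  qed
  have "Cauchy X"
  proof (rule metric_CauchyI)
    fix e :: real assume e: "0 < e"
    then obtain M where M: "4 / e\<^sup>2 < real (Suc M)"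
      using reals_Archimedean2 by (metis less_trans lessI of_nat_less_iff)
    have inv_le: "\<epsilon> n \<le> 1 / real (Suc M)" if "n \<ge> M" for n
      using that by (simp add: \<epsilon>_def frac_le)
    have "dist (X j) (X k) < e" if "j \<ge> M" "k \<ge> M" for j k
    proof -
      have "(norm (X j - X k))\<^sup>2 \<le> 2 * (J (X j) - m) + 2 * (J (X k) - m)"
        by (rule close)
      also have "\<dots> < 2 * \<epsilon> j + 2 * \<epsilon> k"
        using X by (intro add_strict_mono mult_strict_left_mono) (simp_all add: diff_less_eq add.commute)
      also have "\<dots> \<le> 4 / real (Suc M)" using inv_le[OF that(1)] inv_le[OF that(2)] by simp
      also have "\<dots> < e\<^sup>2" using M e by (simp add: field_simps)
      finally show ?thesis using e by (simp add: dist_norm power2_less_imp_less)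
    qed
    then show "\<exists>M. \<forall>j\<ge>M. \<forall>k\<ge>M. dist (X j) (X k) < e" by blast
  qed
  then obtain z where z: "X \<longlonglongrightarrow> z" using Cauchy_convergent convergent_def by blast
  have "(\<lambda>n. J (X n)) \<longlonglongrightarrow> J z"
    unfolding J_def by (intro tendsto_intros z tendsto)
  moreover have "(\<lambda>n. m + \<epsilon> n) \<longlonglongrightarrow> m + 0"
    unfolding \<epsilon>_def by (intro tendsto_intros LIMSEQ_Suc[OF lim_1_over_n])
  ultimately have "J z \<le> m"
    using X by (intro LIMSEQ_le[of "\<lambda>n. J (X n)" "J z" "\<lambda>n. m + \<epsilon> n" m]) (auto intro: less_imp_le)
  then have min: "J z \<le> J x" for x using m_le order_trans by blast
  have "f h = h \<bullet> z" for h
  proof -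
    define g where "g = f h - h \<bullet> z"
    \<comment> \<open>Moving from the minimiser \<open>z\<close> to \<open>z + s h\<close> changes
      \<open>J\<close> by \<open>s^2 (h \<bullet> h) - 2 s g\<close>, which cannot be
      negative.\<close>
    have quad: "2 * s * g \<le> s\<^sup>2 * (h \<bullet> h)" for s
      using min[of "z + s *\<^sub>R h"] unfolding J_def g_def
      by (simp add: inner_add inner_commute add scale algebra_simps power2_eq_square)
    \<comment> \<open>The sharpest choice in \<open>quad\<close> would be
      \<open>g / (h \<bullet> h)\<close>; the added 1 keeps the denominator positive at
      \<open>h = 0\<close> and still forces \<open>s = 0\<close>.\<close>
    define s where "s = g / (h \<bullet> h + 1)"
    have pos: "h \<bullet> h + 1 > 0" by (simp add: add_nonneg_pos)
    have g_eq: "g = s * (h \<bullet> h + 1)" unfolding s_def using pos by simp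
    have "2 * s\<^sup>2 * (h \<bullet> h + 1) \<le> s\<^sup>2 * (h \<bullet> h)"
      using quad[of s] unfolding g_eq by (simp add: power2_eq_square algebra_simps)
    then have "s\<^sup>2 * (h \<bullet> h + 2) \<le> 0" by (simp add: algebra_simps)
    moreover have "h \<bullet> h + 2 > 0" using inner_ge_zero[of h] by linarith
    ultimately have "s = 0" by (simp add: mult_le_0_iff)
    then show ?thesis using g_eq g_def by simp
  qed
  then show ?thesis by blast
qed

text \<open>\<open>adjoint\<close> is defined by choice, so its characteristic equation requires
  some adjoint to exist. The Riesz representers of the functionals \<open>K u \<bullet> v\<close> in
  \<open>u\<close>, one for each \<open>v\<close>, provide it.\<close>

lemma inner_adjoint:
  fixes K :: "'a::{real_inner, complete_space} \<Rightarrow>\<^sub>L 'b::real_inner"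
  shows "K u \<bullet> v = u \<bullet> adjoint (blinfun_apply K) v"
proof -
  have "\<exists>z. \<forall>u. K u \<bullet> v = u \<bullet> z" for v
    by (rule riesz_representation)
      (intro bounded_linear_compose[OF bounded_linear_inner_left] blinfun.bounded_linear_right)
  then have "\<exists>f'. \<forall>u v. K u \<bullet> v = u \<bullet> f' v" by metis
  then have "\<forall>u v. K u \<bullet> v = u \<bullet> adjoint (blinfun_apply K) v"
    unfolding adjoint_def by (rule someI_ex)
  then show ?thesis by blast
qed

text \<open>By properness the values on the effective domain are real, so the extended inequality
  becomes a real one; the domain is convex because the right-hand side stays finite. In this form
  Jensen's inequality \<open>convex_on_sum\<close> applies.\<close>

lemma convex_on_real_of_ereal:
  assumes conv: "convex_fun f" and proper: "proper_fun f"
  shows "convex_on {x. f x \<noteq> \<infinity>} (\<lambda>x. real_of_ereal (f x))"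
proof -
  have comb: "f (u *\<^sub>R x + v *\<^sub>R y) \<le> ereal (u * real_of_ereal (f x) + v * real_of_ereal (f y))"
    if "f x \<noteq> \<infinity>" "f y \<noteq> \<infinity>" "0 \<le> u" "0 \<le> v" "u + v = 1" for x y and u v :: real
  proof -
    have "f x = ereal (real_of_ereal (f x))" "f y = ereal (real_of_ereal (f y))"
      using that proper by (auto simp: proper_fun_def ereal_real)
    then show ?thesis
      using conv that unfolding convex_fun_def by (metis plus_ereal.simps(1) times_ereal.simps(1))
  qed
  then have dom: "f (u *\<^sub>R x + v *\<^sub>R y) \<noteq> \<infinity>"
    if "f x \<noteq> \<infinity>" "f y \<noteq> \<infinity>" "0 \<le> u" "0 \<le> v" "u + v = 1" for x y and u v :: real
    using that by fastforce
  show ?thesis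
    unfolding convex_on_def
  proof (intro conjI ballI allI impI)
    show "convex {x. f x \<noteq> \<infinity>}" unfolding convex_def using dom by blast
    fix x y and u v :: real
    assume a: "x \<in> {x. f x \<noteq> \<infinity>}" "y \<in> {x. f x \<noteq> \<infinity>}" "0 \<le> u" "0 \<le> v" "u + v = 1"
    obtain R where R: "f (u *\<^sub>R x + v *\<^sub>R y) = ereal R"
      using dom[of x y u v] a proper by (cases "f (u *\<^sub>R x + v *\<^sub>R y)") (auto simp: proper_fun_def)
    show "real_of_ereal (f (u *\<^sub>R x + v *\<^sub>R y)) \<le> u * real_of_ereal (f x) + v * real_of_ereal (f y)"
      using comb[of x y u v] a by (simp add: R)
  qed
qed

text \<open>If \<open>f x\<close> were infinite, the subgradient inequality would make
  \<open>f\<close> infinite everywhere.\<close>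

lemma subdifferential_finite:
  assumes "proper_fun f" "p \<in> subdifferential f x"
  shows "f x \<noteq> \<infinity>"
proof
  assume "f x = \<infinity>"
  then have "f x' = \<infinity>" for x'
    using assms(2) unfolding subdifferential_def by (auto split: if_splits)
  then show False using assms(1) unfolding proper_fun_def by auto
qed

text \<open>Jensen's inequality for the normalised weights \<open>c i / S\<close>, multiplied back
  by the total weight \<open>S\<close> because the ergodic estimate compares weighted sums.\<close>

lemma weighted_mean_convex:
  assumes "convex_fun f" "proper_fun f"
    and fin: "\<And>i. f (X i) \<noteq> \<infinity>" and pos: "\<And>i. c i > (0::real)" and "N \<ge> (1::nat)"
  defines "m \<equiv> (1 / (\<Sum>j<N. c j)) *\<^sub>R (\<Sum>i<N. c i *\<^sub>R X i)"
  shows "f m \<noteq> \<infinity>"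
    and "(\<Sum>j<N. c j) * real_of_ereal (f m) \<le> (\<Sum>i<N. c i * real_of_ereal (f (X i)))"
proof -
  let ?S = "\<Sum>j<N. c j"
  have ne: "{..<N} \<noteq> {}" using \<open>N \<ge> 1\<close> by (auto simp: lessThan_empty_iff)
  have S: "?S > 0" using ne pos by (intro sum_pos) auto
  have m: "m = (\<Sum>i<N. (c i / ?S) *\<^sub>R X i)"
    unfolding m_def by (simp add: scaleR_sum_right)
  have one: "(\<Sum>i<N. c i / ?S) = 1" using S by (simp add: sum_divide_distrib[symmetric])
  note cv = convex_on_real_of_ereal[OF assms(1,2)]
  have nn: "0 \<le> c i / ?S" for i using pos[of i] S by simp
  have "m \<in> {x. f x \<noteq> \<infinity>}"
    unfolding m using cv one nn fin by (intro convex_sum) (auto simp: convex_on_def)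
  then show "f m \<noteq> \<infinity>" by simp
  have "real_of_ereal (f m) \<le> (\<Sum>i<N. (c i / ?S) * real_of_ereal (f (X i)))"
    unfolding m using ne one nn fin by (intro convex_on_sum[OF _ _ cv]) auto
  also have "\<dots> = (\<Sum>i<N. c i * real_of_ereal (f (X i))) / ?S"
    by (simp add: sum_divide_distrib)
  finally show "?S * real_of_ereal (f m) \<le> (\<Sum>i<N. c i * real_of_ereal (f (X i)))"
    using S by (simp add: field_simps)
qed

lemma real_of_ereal_diff_ge:
  assumes "proper_fun f" "f u \<noteq> \<infinity>" "f u' \<noteq> \<infinity>" "f u' - f u \<ge> ereal c"
  shows "real_of_ereal (f u') - real_of_ereal (f u) \<ge> c"
proof -
  obtain a b where "f u = ereal a" "f u' = ereal b"
    using assms(1-3) unfolding proper_fun_def by (metis ereal_cases)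
  then show ?thesis using assms(4) by simp
qed

lemma subgradient_real:
  assumes "proper_fun f" "p \<in> subdifferential f u" "f u' \<noteq> \<infinity>"
  shows "real_of_ereal (f u) + p \<bullet> (u' - u) \<le> real_of_ereal (f u')"
proof -
  obtain a b where "f u = ereal a" "f u' = ereal b"
    using assms(1,3) subdifferential_finite[OF assms(1,2)] unfolding proper_fun_def by (metis ereal_cases)
  then show ?thesis using assms(2) by (auto simp: subdifferential_def dest: spec[of _ u'])
qed

subsection \<open>Step length sequences\<close>

text \<open>The step lengths evolve independently of the iterates, so their growth is a purely
  scalar question.\<close>

locale accelerated_steps =
  fixes \<gamma> \<zeta> :: real and w wp t tp :: "nat \<Rightarrow> real"
  assumes \<gamma>_pos: "0 < \<gamma>" and \<zeta>_pos: "0 < \<zeta>"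
    and t0_pos: "0 < t 0" and tp0_pos: "0 < tp 0" and \<zeta>_le: "\<zeta> \<le> 1 / (tp 0)\<^sup>2"
    and w_eq: "\<And>i. w i = 1 / sqrt (1 + 2 * \<gamma> * t i)"
    and wp_eq: "\<And>i. wp i = 1/2 * ((1 - 1 / (\<zeta> * (tp i)\<^sup>2)) * w i
              + sqrt ((1 - 1 / (\<zeta> * (tp i)\<^sup>2))\<^sup>2 * (w i)\<^sup>2 + 4 / (\<zeta> * (tp i)\<^sup>2)))"
    and t_Suc: "\<And>i. t (Suc i) = t i * w i" and tp_Suc: "\<And>i. tp (Suc i) = tp i * wp i"
begin

definition r :: "nat \<Rightarrow> real" where "r i = tp i / t i"

lemma t_pos: "t i > 0"
proof (induction i)
  case (Suc i)
  then have "1 + 2 * \<gamma> * t i > 0" using \<gamma>_pos by (simp add: add_pos_nonneg)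
  then show ?case using Suc by (simp add: t_Suc w_eq)
qed (fact t0_pos)

lemma w_pos: "w i > 0" and w_le_1: "w i \<le> 1" and w_sq: "(w i)\<^sup>2 * (1 + 2 * \<gamma> * t i) = 1"
proof -
  have 1: "1 + 2 * \<gamma> * t i > 1" using \<gamma>_pos t_pos[of i] by simp
  then show "w i > 0" "w i \<le> 1" by (simp_all add: w_eq)
  show "(w i)\<^sup>2 * (1 + 2 * \<gamma> * t i) = 1" using 1 by (simp add: w_eq power_divide)
qed

lemma wp_root:
  assumes "tp i > 0" "\<zeta> * (tp i)\<^sup>2 \<le> 1"
  shows "\<zeta> * (tp i)\<^sup>2 * wp i * (wp i - w i) = 1 - w i * wp i" "1 \<le> wp i" "\<zeta> * (tp i)\<^sup>2 * (wp i)\<^sup>2 \<le> 1"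
proof -
  define c where "c = 1 / (\<zeta> * (tp i)\<^sup>2)"
  have pos: "\<zeta> * (tp i)\<^sup>2 > 0" using assms \<zeta>_pos by simp
  then have c: "c \<ge> 1" "\<zeta> * (tp i)\<^sup>2 * c = 1" using assms \<zeta>_pos by (simp_all add: c_def)
  define z where "z = wp i"
  define a where "a = (1 - c) * w i"
  have z: "z = (a + sqrt (a\<^sup>2 + 4 * c)) / 2"
    unfolding z_def a_def wp_eq c_def by (simp add: power_mult_distrib)
  have "\<bar>a\<bar> = sqrt (a\<^sup>2)" by simp
  also have "\<dots> < sqrt (a\<^sup>2 + 4 * c)" using c by (intro real_sqrt_less_mono) simp
  finally have zpos: "z > 0" unfolding z by (simp add: field_simps)
  have "2 * z - a = sqrt (a\<^sup>2 + 4 * c)" unfolding z by (simp add: field_simps)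
  then have "(2 * z - a)\<^sup>2 = a\<^sup>2 + 4 * c" using c by simp
  then have root: "z * z = a * z + c" by (simp add: power2_eq_square algebra_simps)
  \<comment> \<open>z is the positive root of Z^2 - (1 - c) w Z - c, which is nonpositive at 1 and nonnegative at sqrt c.\<close>
  have "(z - 1) * (z + c) = (c - 1) * z * (1 - w i)"
    using root unfolding a_def by (simp add: algebra_simps)
  also have "\<dots> \<ge> 0" using c zpos w_le_1[of i] by (intro mult_nonneg_nonneg) auto
  finally have "z - 1 \<ge> 0" using zpos c by (simp add: zero_le_mult_iff)
  then show "1 \<le> wp i" by (simp add: z_def)
  have "a * z \<le> 0" unfolding a_def using c zpos w_pos[of i] by (simp add: mult_nonpos_nonneg)
  then have "z\<^sup>2 \<le> c" using root by (simp add: power2_eq_square)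
  then have "\<zeta> * (tp i)\<^sup>2 * z\<^sup>2 \<le> \<zeta> * (tp i)\<^sup>2 * c" using pos by (intro mult_left_mono) auto
  then show "\<zeta> * (tp i)\<^sup>2 * (wp i)\<^sup>2 \<le> 1" using c by (simp add: z_def)
  have "z * (z - w i) = c * (1 - w i * z)" using root unfolding a_def by (simp add: algebra_simps)
  then have "\<zeta> * (tp i)\<^sup>2 * (z * (z - w i)) = (\<zeta> * (tp i)\<^sup>2 * c) * (1 - w i * z)" by simp
  then show "\<zeta> * (tp i)\<^sup>2 * wp i * (wp i - w i) = 1 - w i * wp i" 
    unfolding c(2) by (simp add: z_def mult.assoc)
qed

text \<open>Both facts must be carried through the induction: \<open>wp_root\<close> needs them at
  \<open>i\<close>, and its bounds on \<open>wp i\<close> return them at \<open>Suc i\<close>. The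
  base case is the restriction on \<zeta>.\<close>

lemma tp_bounds: "tp i > 0 \<and> \<zeta> * (tp i)\<^sup>2 \<le> 1"
proof (induction i)
  case 0
  then show ?case using tp0_pos \<zeta>_le by (simp add: field_simps)
next
  case (Suc i)
  then show ?case using wp_root(2,3)[of i]
    by (auto simp: tp_Suc power_mult_distrib mult.assoc intro: mult_pos_pos)
qed

lemmas tp_pos = tp_bounds[THEN conjunct1] and tp_sq_le = tp_bounds[THEN conjunct2]
lemmas wp_eqn = wp_root(1)[OF tp_pos tp_sq_le] and wp_ge_1 = wp_root(2)[OF tp_pos tp_sq_le]

section \<open>Decay of \<open>t\<close> and growth of its reciprocal\<close>

lemma t_Suc_le: "t (Suc i) \<le> t i"
  using t_pos[of i] w_le_1[of i] by (simp add: t_Suc mult_left_le)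

lemma t_le_t0: "t i \<le> t 0"
  by (induction i) (auto intro: order_trans[OF t_Suc_le])

text \<open>This is \<open>w_sq\<close> divided by the square of
  \<open>t (Suc i) = t i w i\<close>.\<close>

lemma inverse_t_Suc_sq: "1 / (t (Suc i))\<^sup>2 = 1 / (t i)\<^sup>2 + 2 * \<gamma> / t i"
proof -
  have "1 / (t (Suc i))\<^sup>2 = ((w i)\<^sup>2 * (1 + 2 * \<gamma> * t i)) / (t (Suc i))\<^sup>2" by (simp only: w_sq)
  also have "\<dots> = 1 / (t i)\<^sup>2 + 2 * \<gamma> / t i"
    using t_pos[of i] w_pos[of i]
    by (simp add: t_Suc power_mult_distrib) (simp add: field_simps power2_eq_square)
  finally show ?thesis .
qed

lemma inverse_t_sq: "1 / (t N)\<^sup>2 = 1 / (t 0)\<^sup>2 + 2 * \<gamma> * (\<Sum>j<N. 1 / t j)"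
proof (induction N)
  case (Suc N)
  have "1 / (t (Suc N))\<^sup>2 = 1 / (t N)\<^sup>2 + 2 * \<gamma> / t N" by (fact inverse_t_Suc_sq)
  also have "\<dots> = 1 / (t 0)\<^sup>2 + 2 * \<gamma> * ((\<Sum>j<N. 1 / t j) + 1 / t N)"
    unfolding Suc by (simp add: distrib_left)
  finally show ?case by simp
qed simp

text \<open>Supplies the factor in front of the gap. With \<open>q\<close> the sum of the averaging
  weights, \<open>inverse_t_sq\<close> gives 1 / \<open>t N\<close>^2 = 1 / \<open>t 0\<close>^2 + 2
  \<gamma> \<open>q\<close>, and the first term on the right is at most \<open>q\<close> /
  \<open>t 0\<close>.\<close>

lemma weight_sum_ge:
  assumes "N \<ge> 1"
  shows "1 / (1 / t 0 + 2 * \<gamma>) \<le> (t N)\<^sup>2 * (\<Sum>j<N. 1 / t j)"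
proof -
  define q where "q = (\<Sum>j<N. 1 / t j)"
  \<comment> \<open>Only the first summand is kept; it is present because
    \<open>N \<ge> 1\<close>.\<close>
  have "(\<Sum>j\<in>{0}. 1 / t j) \<le> q"
    unfolding q_def using assms t_pos by (intro sum_mono2) (auto intro: less_imp_le)
  then have q: "q \<ge> 1 / t 0" by simp
  have "1 / t 0 > 0" using t_pos by simp
  then have qp: "q > 0" using q by linarith
  have "1 / (t N)\<^sup>2 = 1 / (t 0)\<^sup>2 + 2 * \<gamma> * q" unfolding q_def by (fact inverse_t_sq)
  also have "1 / (t 0)\<^sup>2 \<le> q * (1 / t 0)"
    using mult_right_mono[OF q, of "1 / t 0"] t_pos[of 0] by (simp add: power2_eq_square)
  finally have "1 / (t N)\<^sup>2 \<le> q * (1 / t 0 + 2 * \<gamma>)" by (simp add: algebra_simps)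
  moreover have "1 / t 0 + 2 * \<gamma> > 0" using t_pos[of 0] \<gamma>_pos by (simp add: add_pos_pos)
  ultimately show ?thesis
    using t_pos[of N] unfolding q_def[symmetric] by (simp add: divide_le_eq mult.assoc[symmetric] mult.commute)
qed

lemma w_ge_w_0: "w 0 \<le> w i"
  unfolding w_eq using t_le_t0[of i] t_pos \<gamma>_pos
  by (intro divide_left_mono mult_pos_pos real_sqrt_le_mono) (auto simp: add_pos_nonneg less_imp_le)

text \<open>With \<open>h = 1 / t i\<close> and \<open>h'\<close> its successor, h'^2 - h^2 = 2
  \<gamma> h factors as (h' - h)(h' + h). Bounding h' + h by 2 h' and inserting h = h'
  \<open>w i\<close> gives h' - h \<ge> \<gamma> \<open>w i\<close>, and \<open>w\<close> is
  smallest at index 0.\<close>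

lemma inverse_t_growth: "1 / t (Suc i) \<ge> 1 / t i + \<gamma> * w 0"
proof -
  define h h' where "h = 1 / t i" and "h' = 1 / t (Suc i)"
  have h: "h > 0" using t_pos[of i] by (simp add: h_def)
  have hw: "h = h' * w i" using t_pos[of i] w_pos[of i] by (simp add: h_def h'_def t_Suc)
  have "h'\<^sup>2 = h\<^sup>2 + 2 * \<gamma> * h" using inverse_t_Suc_sq[of i] by (simp add: h_def h'_def power_divide)
  then have "(h' - h) * (h' + h) = 2 * \<gamma> * (h' * w i)"
    unfolding hw[symmetric] by (simp add: power2_eq_square algebra_simps)
  moreover have hh: "h' \<ge> h" unfolding h_def h'_def using t_pos t_Suc_le by (intro divide_left_mono) auto
  ultimately have "2 * \<gamma> * (h' * w i) \<le> (h' - h) * (2 * h')"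
    by (metis add_left_mono diff_ge_0_iff_ge mult_2 mult_left_mono)
  then have "h' * (\<gamma> * w i) \<le> h' * (h' - h)" by (simp add: algebra_simps)
  then have "\<gamma> * w i \<le> h' - h" using h hh by simp
  moreover have "\<gamma> * w 0 \<le> \<gamma> * w i" using w_ge_w_0[of i] \<gamma>_pos by simp
  ultimately show ?thesis by (simp add: h_def h'_def)
qed

text \<open>The source of the rate: the constant 1 / (\<gamma> \<open>w 0\<close>) is the final
  \<open>Ctau\<close>.\<close>

lemma t_le:
  assumes "N \<ge> 1"
  shows "t N \<le> (1 / (\<gamma> * w 0)) / real N"
proof -
  have "real N * (\<gamma> * w 0) \<le> 1 / t N"
  proof (induction N)
    case 0 then show ?case using t_pos[of 0] by (simp add: less_imp_le)
  next
    case (Suc N) then show ?case using inverse_t_growth[of N] by (simp add: algebra_simps)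
  qed
  then show ?thesis using assms t_pos[of N] \<gamma>_pos w_pos[of 0] by (simp add: field_simps)
qed

section \<open>The ratio of the two primal step lengths\<close>

lemma r_pos: "r i > 0"
  using tp_pos t_pos by (simp add: r_def)

text \<open>The increment is multiplied by \<open>t i\<close> because this product is what the
  modulus \<open>gp\<close> will be proportional to.\<close>

lemma r_diff: "t i * (r (Suc i) - r i) = tp i * (wp i - w i) / w i"
  using t_pos[of i] w_pos[of i] by (simp add: r_def t_Suc tp_Suc field_simps)

lemma r_mono: "r i \<le> r (Suc i)"
proof -
  have "0 \<le> t i * (r (Suc i) - r i)"
    unfolding r_diff using tp_pos[of i] w_pos[of i] wp_ge_1[of i] w_le_1[of i] by simp
  then show ?thesis using t_pos[of i] by (simp add: zero_le_mult_iff)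
qed

text \<open>Dividing the quadratic equation \<open>wp_eqn\<close> by
  \<open>t i tp i w i wp i\<close> turns its left side into \<zeta> times the increment of
  \<open>r\<close> and its right side into a difference of reciprocals.\<close>

lemma inverse_t_tp_Suc:
  "1 / (t (Suc i) * tp (Suc i)) = 1 / (t i * tp i) + \<zeta> * (r (Suc i) - r i)"
proof -
  have pos: "t i > 0" "tp i > 0" "w i > 0" "wp i > 0"
    using t_pos tp_pos w_pos wp_ge_1[of i] by auto
  have "\<zeta> * (r (Suc i) - r i) = (\<zeta> * (tp i)\<^sup>2 * wp i * (wp i - w i)) / (t i * tp i * w i * wp i)"
    using pos by (simp add: r_def t_Suc tp_Suc field_simps power2_eq_square)
  also have "\<dots> = 1 / (t (Suc i) * tp (Suc i)) - 1 / (t i * tp i)"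
    unfolding wp_eqn using pos by (simp add: t_Suc tp_Suc field_simps)
  finally show ?thesis by simp
qed

text \<open>One factor \<open>wp i - w i\<close> is enlarged to \<open>wp i\<close>, so that
  \<open>wp_eqn\<close> applies and leaves 1 - \<open>w i wp i\<close>, at most 1 -
  \<open>w i\<close>^2 = 2 \<gamma> \<open>t i\<close> \<open>w i\<close>^2. Together with the bound
  on \<open>t 0\<close> this keeps the moduli admissible.\<close>

lemma r_increment_sq: "\<zeta> * (t i * (r (Suc i) - r i))\<^sup>2 \<le> 2 * \<gamma> * t i"
proof -
  have pos: "tp i > 0" "w i > 0" "wp i \<ge> w i"
    using tp_pos w_pos wp_ge_1[of i] w_le_1[of i] by auto
  have "\<zeta> * (t i * (r (Suc i) - r i))\<^sup>2 * (w i)\<^sup>2 = \<zeta> * (tp i)\<^sup>2 * ((wp i - w i) * (wp i - w i))"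
    unfolding r_diff using pos by (simp add: power_mult_distrib power_divide power2_eq_square)
  also have "\<dots> \<le> \<zeta> * (tp i)\<^sup>2 * (wp i * (wp i - w i))"
    using pos \<zeta>_pos by (intro mult_left_mono mult_right_mono) auto
  also have "\<dots> = 1 - w i * wp i" using wp_eqn[of i] by (simp add: mult.assoc)
  also have "\<dots> \<le> 1 - (w i)\<^sup>2" using pos by (simp add: power2_eq_square mult_left_mono)
  also have "\<dots> = 2 * \<gamma> * t i * (w i)\<^sup>2" using w_sq[of i] by (simp add: algebra_simps)
  finally show ?thesis using pos by simp
qed

lemma r_le: "r N \<le> 1 / (sqrt \<zeta> * t N)"
proof -
  have "(sqrt \<zeta> * tp N)\<^sup>2 \<le> 1" using tp_sq_le[of N] \<zeta>_pos by (simp add: power_mult_distrib)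
  then have "sqrt \<zeta> * tp N \<le> 1" by (metis one_power2 power2_le_imp_le zero_le_one)
  then show ?thesis using t_pos[of N] \<zeta>_pos by (simp add: r_def field_simps)
qed

end

subsection \<open>The energy estimate\<close>

lemma le_of_power2_le_mult: "(a::real)\<^sup>2 \<le> B * a \<Longrightarrow> 0 \<le> a \<Longrightarrow> 0 \<le> B \<Longrightarrow> a \<le> B"
  by (cases "a = 0") (auto simp: power2_eq_square)

lemma inner_le_Young:
  fixes a b :: "'a::real_inner"
  assumes "c > 0"
  shows "a \<bullet> b \<le> c / 2 * (norm a)\<^sup>2 + (norm b)\<^sup>2 / (2 * c)"
proof -
  have "0 \<le> (c *\<^sub>R a - b) \<bullet> (c *\<^sub>R a - b)" by simp
  then have "2 * c * (a \<bullet> b) \<le> c\<^sup>2 * (norm a)\<^sup>2 + (norm b)\<^sup>2"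
    unfolding power2_norm_eq_inner by (simp add: inner_diff inner_commute power2_eq_square algebra_simps)
  then show ?thesis using assms by (simp add: field_simps power2_eq_square)
qed

lemma inner_diff_self:
  fixes a b :: "'a::real_inner"
  shows "(a - b) \<bullet> a = ((norm a)\<^sup>2 + (norm (a - b))\<^sup>2 - (norm b)\<^sup>2) / 2"
  by (simp add: power2_norm_eq_inner inner_diff inner_commute algebra_simps)

text \<open>The subgradients selected by the two resolvents appear as sequences \<open>p\<close> and
  \<open>q\<close> tied to the iterates by linear equations; their membership in subdifferentials
  enters in \<open>pdhgm_partial_strong\<close>.\<close>

locale pdhgm_iterates = accelerated_steps \<gamma> \<zeta> w wp t tp
  for \<gamma> \<zeta> :: real and w wp t tp :: "nat \<Rightarrow> real" +
  fixes K :: "'a::{real_inner, complete_space} \<Rightarrow>\<^sub>L 'b::real_inner" and P :: "'a \<Rightarrow>\<^sub>L 'a"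
    and \<delta> :: real and s :: "nat \<Rightarrow> real" and x p :: "nat \<Rightarrow> 'a" and y q :: "nat \<Rightarrow> 'b"
    and xh :: 'a and yh :: 'b
  assumes K_nonzero: "K \<noteq> 0"
    and P_idem: "P o\<^sub>L P = P" and P_adjoint: "adjoint (blinfun_apply P) = blinfun_apply P"
    and \<delta>_pos: "0 < \<delta>" and \<delta>_less_1: "\<delta> < 1"
    and s_Suc: "\<And>i. s (Suc i) = (1 / w i) * (1 - \<delta>)
              / (max 0 (t i - tp i) * (norm (K o\<^sub>L P))\<^sup>2 + tp i * (norm K)\<^sup>2)"
    and primal_step: "\<And>i. x i - (t i *\<^sub>R P + tp i *\<^sub>R (id_blinfun - P)) (adjoint (blinfun_apply K) (y i))
              = x (Suc i) + (t i *\<^sub>R P + tp i *\<^sub>R (id_blinfun - P)) (p i)"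
    and dual_step: "\<And>i. y i + s (Suc i) *\<^sub>R K (w i *\<^sub>R (x (Suc i) - x i) + x (Suc i))
              = y (Suc i) + s (Suc i) *\<^sub>R q i"
begin

section \<open>Orthogonal splitting and bounds for the adjoint\<close>

abbreviation Q :: "'a \<Rightarrow>\<^sub>L 'a" where "Q \<equiv> id_blinfun - P"
abbreviation Kadj :: "'b \<Rightarrow> 'a" where "Kadj \<equiv> adjoint (blinfun_apply K)"

lemma P_P: "P (P u) = P u"
  using P_idem by (metis blinfun_apply_blinfun_compose)

lemma Q_apply: "Q u = u - P u"
  by (simp add: blinfun.diff_left)

lemma P_symmetric: "P u \<bullet> v = u \<bullet> P v"
  using inner_adjoint[of P u v] P_adjoint by simp

lemma inner_split: "u \<bullet> v = P u \<bullet> P v + Q u \<bullet> Q v"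
proof -
  have "P u \<bullet> P v = u \<bullet> P v" "P u \<bullet> v = u \<bullet> P v" by (simp_all add: P_symmetric P_P)
  then show ?thesis by (simp add: Q_apply inner_diff)
qed

lemma norm_sq_split: "(norm u)\<^sup>2 = (norm (P u))\<^sup>2 + (norm (Q u))\<^sup>2"
  using inner_split[of u u] by (simp add: power2_norm_eq_inner)

lemma norm_Kadj_le: "norm (Kadj v) \<le> norm K * norm v"
proof (rule le_of_power2_le_mult)
  have "(norm (Kadj v))\<^sup>2 = K (Kadj v) \<bullet> v" by (simp add: inner_adjoint power2_norm_eq_inner)
  also have "\<dots> \<le> norm (K (Kadj v)) * norm v" by (rule norm_cauchy_schwarz)
  also have "\<dots> \<le> (norm K * norm (Kadj v)) * norm v" by (intro mult_right_mono norm_blinfun) simp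
  finally show "(norm (Kadj v))\<^sup>2 \<le> norm K * norm v * norm (Kadj v)" by (simp add: mult_ac)
qed simp_all

text \<open>\<open>P\<close> after \<open>Kadj\<close> is the adjoint of
  \<open>K o\<^sub>L P\<close>, so the argument of \<open>norm_Kadj_le\<close> repeats with that
  operator.\<close>

lemma norm_P_Kadj_le: "norm (P (Kadj v)) \<le> norm (K o\<^sub>L P) * norm v"
proof (rule le_of_power2_le_mult)
  let ?g = "P (Kadj v)"
  have "(norm ?g)\<^sup>2 = ?g \<bullet> Kadj v" by (simp add: power2_norm_eq_inner P_symmetric P_P)
  also have "\<dots> = (K o\<^sub>L P) ?g \<bullet> v" by (simp add: inner_adjoint P_P)
  also have "\<dots> \<le> norm ((K o\<^sub>L P) ?g) * norm v" by (rule norm_cauchy_schwarz)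
  also have "\<dots> \<le> (norm (K o\<^sub>L P) * norm ?g) * norm v" by (intro mult_right_mono norm_blinfun) simp
  finally show "(norm ?g)\<^sup>2 \<le> norm (K o\<^sub>L P) * norm v * norm ?g" by (simp add: mult_ac)
qed simp_all

text \<open>An upper bound, for positive \<open>c\<close>, of the quadratic form of \<open>K\<close>
  (\<open>P\<close> + c \<open>Q\<close>) \<open>Kadj\<close>, as \<open>Kadj_load\<close>
  shows.\<close>

definition load :: "real \<Rightarrow> real" where
  "load c = max 0 (1 - c) * (norm (K o\<^sub>L P))\<^sup>2 + c * (norm K)\<^sup>2"

lemma load_pos: "c > 0 \<Longrightarrow> load c > 0"
  unfolding load_def using K_nonzero by (intro add_nonneg_pos) auto

lemma load_diff_le:
  assumes "c \<le> d"
  shows "load d - load c \<le> (norm K)\<^sup>2 * (d - c)"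
proof -
  have "max 0 (1 - d) * (norm (K o\<^sub>L P))\<^sup>2 \<le> max 0 (1 - c) * (norm (K o\<^sub>L P))\<^sup>2"
    using assms by (intro mult_right_mono) auto
  then show ?thesis unfolding load_def by (simp add: algebra_simps)
qed

lemma Kadj_load:
  assumes "c > 0"
  shows "(norm (P (Kadj v)))\<^sup>2 + c * (norm (Q (Kadj v)))\<^sup>2 \<le> load c * (norm v)\<^sup>2"
proof -
  let ?g = "Kadj v"
  have g: "(norm ?g)\<^sup>2 \<le> (norm K)\<^sup>2 * (norm v)\<^sup>2"
    using power_mono[OF norm_Kadj_le, of v 2] by (simp add: power_mult_distrib)
  have Pg: "(norm (P ?g))\<^sup>2 \<le> (norm (K o\<^sub>L P))\<^sup>2 * (norm v)\<^sup>2"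
    using power_mono[OF norm_P_Kadj_le, of v 2] by (simp add: power_mult_distrib)
  have "(norm (P ?g))\<^sup>2 + c * (norm (Q ?g))\<^sup>2 = (1 - c) * (norm (P ?g))\<^sup>2 + c * (norm ?g)\<^sup>2"
    by (simp add: norm_sq_split[of ?g] algebra_simps)
  \<comment> \<open>The coefficient 1 - c may be negative, and then the bound on \<open>P ?g\<close>
    could not be inserted; this explains the maximum in \<open>load\<close>.\<close>
  also have "\<dots> \<le> max 0 (1 - c) * (norm (P ?g))\<^sup>2 + c * (norm ?g)\<^sup>2"
    by (intro add_right_mono mult_right_mono) auto
  also have "\<dots> \<le> max 0 (1 - c) * ((norm (K o\<^sub>L P))\<^sup>2 * (norm v)\<^sup>2) + c * ((norm K)\<^sup>2 * (norm v)\<^sup>2)"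
    using g Pg assms by (intro add_mono mult_left_mono) auto
  finally show ?thesis by (simp add: load_def algebra_simps)
qed

text \<open>Young's inequality is applied to the two components separately. The weights 1 - \<delta>
  and (1 - \<delta>) / c make the dual parts combine into the form bounded by
  \<open>Kadj_load\<close>, and the factor 1 - \<delta> leaves a share \<delta> of the primal
  norm.\<close>

lemma coupling_bound:
  assumes "c > 0"
  shows "K u \<bullet> v \<le> (1 - \<delta>) / 2 * ((norm (P u))\<^sup>2 + (norm (Q u))\<^sup>2 / c)
    + load c / (2 * (1 - \<delta>)) * (norm v)\<^sup>2"
proof -
  let ?g = "Kadj v"
  have d: "1 - \<delta> > 0" using \<delta>_less_1 by simp
  have "K u \<bullet> v = P u \<bullet> P ?g + Q u \<bullet> Q ?g" unfolding inner_adjoint[of K] by (rule inner_split)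
  also have "P u \<bullet> P ?g \<le> (1 - \<delta>) / 2 * (norm (P u))\<^sup>2 + (norm (P ?g))\<^sup>2 / (2 * (1 - \<delta>))"
    using d by (rule inner_le_Young)
  also have "Q u \<bullet> Q ?g \<le> ((1 - \<delta>) / c) / 2 * (norm (Q u))\<^sup>2 + (norm (Q ?g))\<^sup>2 / (2 * ((1 - \<delta>) / c))"
    using d assms by (intro inner_le_Young) simp
  also have "(1 - \<delta>) / 2 * (norm (P u))\<^sup>2 + (norm (P ?g))\<^sup>2 / (2 * (1 - \<delta>)) + \<dots>
      = (1 - \<delta>) / 2 * ((norm (P u))\<^sup>2 + (norm (Q u))\<^sup>2 / c)
        + ((norm (P ?g))\<^sup>2 + c * (norm (Q ?g))\<^sup>2) / (2 * (1 - \<delta>))"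
    using d assms by (simp add: add_divide_distrib distrib_left mult.commute)
  also have "((norm (P ?g))\<^sup>2 + c * (norm (Q ?g))\<^sup>2) / (2 * (1 - \<delta>)) \<le> load c * (norm v)\<^sup>2 / (2 * (1 - \<delta>))"
    using Kadj_load[OF assms] d by (intro divide_right_mono) auto
  finally show ?thesis by simp
qed

text \<open>The diagonal part of the energy is kept apart since its index and that of the coupling
  term advance separately: \<open>energy_identity\<close> has the former at \<open>i\<close> and the
  latter already at \<open>Suc i\<close>.\<close>

definition half_sq :: "nat \<Rightarrow> 'a \<Rightarrow> 'b \<Rightarrow> real" where
  "half_sq i u v = (1 / (t i)\<^sup>2 * (norm (P u))\<^sup>2 + 1 / (t i * tp i) * (norm (Q u))\<^sup>2
      + load (r i) / (1 - \<delta>) * (norm v)\<^sup>2) / 2"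

definition energy :: "nat \<Rightarrow> 'a \<Rightarrow> 'b \<Rightarrow> real" where
  "energy i u v = half_sq i u v - K u \<bullet> v / t i"

text \<open>\<open>coupling_bound\<close> is applied to \<open>u / t i\<close> with
  \<open>c = r i\<close>; since \<open>t i\<close>^2 \<open>r i\<close> = \<open>t i tp i\<close>,
  its weights are those of the energy.\<close>

lemma energy_ge: "\<delta> / 2 * (norm (P u))\<^sup>2 / (t i)\<^sup>2 \<le> energy i u v"
proof -
  have t: "t i > 0" and tp: "tp i > 0" by (rule t_pos, rule tp_pos)
  let ?p = "(norm (P u))\<^sup>2 / (t i)\<^sup>2" and ?q = "(norm (Q u))\<^sup>2 / (t i * tp i)"
  let ?u = "(1 / t i) *\<^sub>R u"
  have 1: "(norm (P ?u))\<^sup>2 = ?p"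
    using t by (simp add: blinfun.scaleR_right power_divide)
  have 2: "(norm (Q ?u))\<^sup>2 / r i = ?q"
    using t tp by (simp add: blinfun.scaleR_right power_divide r_def) (simp add: field_simps power2_eq_square)
  have 3: "K ?u \<bullet> v = K u \<bullet> v / t i" by (simp add: blinfun.scaleR_right)
  define S L where "S = ?p + ?q" and "L = load (r i) / (2 * (1 - \<delta>)) * (norm v)\<^sup>2"
  have "K u \<bullet> v / t i \<le> (1 - \<delta>) / 2 * S + L"
    using coupling_bound[OF r_pos, of ?u v i] unfolding 1 2 3 S_def L_def .
  moreover have "(1 - \<delta>) / 2 * S = S / 2 - \<delta> / 2 * S" by (simp add: field_simps)
  moreover have "energy i u v = S / 2 + L - K u \<bullet> v / t i"
    by (simp add: energy_def half_sq_def S_def L_def add_divide_distrib)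
  ultimately have "\<delta> / 2 * S \<le> energy i u v" by linarith
  then have "\<delta> / 2 * ?p + \<delta> / 2 * ?q \<le> energy i u v" by (simp only: S_def distrib_left)
  moreover have "0 \<le> \<delta> / 2 * ?q" using \<delta>_pos t tp by simp
  ultimately show ?thesis by simp
qed

lemma energy_nonneg: "0 \<le> energy i u v"
  by (rule order_trans[OF _ energy_ge]) (use \<delta>_pos in simp)

text \<open>The increments of the \<open>P\<close> and \<open>Q\<close> coefficients are exact; only
  the dual one is estimated, by \<open>load_diff_le\<close>.\<close>

lemma half_sq_Suc:
  "half_sq (Suc i) u v \<le> half_sq i u v + \<gamma> / t i * (norm (P u))\<^sup>2
    + (r (Suc i) - r i) / 2 * (\<zeta> * (norm (Q u))\<^sup>2 + (norm K)\<^sup>2 / (1 - \<delta>) * (norm v)\<^sup>2)"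
proof -
  have half: "A / 2 \<le> B / 2 + d / 2 * M" if "A \<le> B + d * M" for A B d M :: real
    using that by simp
  have "load (r (Suc i)) / (1 - \<delta>) * (norm v)\<^sup>2
      \<le> (load (r i) + (norm K)\<^sup>2 * (r (Suc i) - r i)) / (1 - \<delta>) * (norm v)\<^sup>2"
    using load_diff_le[OF r_mono, of i] \<delta>_less_1 by (intro mult_right_mono divide_right_mono) auto
  also have "\<dots> = load (r i) / (1 - \<delta>) * (norm v)\<^sup>2
        + (r (Suc i) - r i) * ((norm K)\<^sup>2 / (1 - \<delta>) * (norm v)\<^sup>2)"
    by (simp add: add_divide_distrib distrib_right)
  finally have "load (r (Suc i)) / (1 - \<delta>) * (norm v)\<^sup>2 \<le> \<dots>" .
  then have "load (r (Suc i)) / (1 - \<delta>) * (norm v)\<^sup>2 / 2 \<le> load (r i) / (1 - \<delta>) * (norm v)\<^sup>2 / 2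
      + (r (Suc i) - r i) / 2 * ((norm K)\<^sup>2 / (1 - \<delta>) * (norm v)\<^sup>2)" by (rule half)
  moreover have "half_sq (Suc i) u v = 1 / (t i)\<^sup>2 * (norm (P u))\<^sup>2 / 2 + \<gamma> / t i * (norm (P u))\<^sup>2
      + 1 / (t i * tp i) * (norm (Q u))\<^sup>2 / 2 + (r (Suc i) - r i) / 2 * (\<zeta> * (norm (Q u))\<^sup>2)
      + load (r (Suc i)) / (1 - \<delta>) * (norm v)\<^sup>2 / 2"
    unfolding half_sq_def inverse_t_Suc_sq inverse_t_tp_Suc
    by (simp add: add_divide_distrib distrib_right)
  moreover have "half_sq i u v = 1 / (t i)\<^sup>2 * (norm (P u))\<^sup>2 / 2
      + 1 / (t i * tp i) * (norm (Q u))\<^sup>2 / 2 + load (r i) / (1 - \<delta>) * (norm v)\<^sup>2 / 2"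
    unfolding half_sq_def by (simp add: add_divide_distrib)
  ultimately show ?thesis unfolding distrib_left[of "(r (Suc i) - r i) / 2"] by argo
qed

text \<open>The primal step writes the increment of \<open>x\<close> as minus the step operator
  applied to \<open>p i + Kadj (y i)\<close>. That operator acts as \<open>t i\<close> on the range
  of \<open>P\<close> and as \<open>tp i\<close> on the range of \<open>Q\<close>, so it is inverted
  componentwise; exchanging \<open>y i\<close> for \<open>yh\<close> leaves the coupling
  term.\<close>

lemma primal_residual:
  "(p i + Kadj yh) \<bullet> (x (Suc i) - xh) / t i
    = - (1 / (t i)\<^sup>2 * (P (x (Suc i) - x i) \<bullet> P (x (Suc i) - xh))
         + 1 / (t i * tp i) * (Q (x (Suc i) - x i) \<bullet> Q (x (Suc i) - xh)))
      - K (x (Suc i) - xh) \<bullet> (y i - yh) / t i"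
proof -
  let ?u = "x (Suc i) - xh" and ?d = "x (Suc i) - x i" and ?z = "p i + Kadj (y i)"
  have t: "t i > 0" and tp: "tp i > 0" by (rule t_pos, rule tp_pos)
  have T: "(t i *\<^sub>R P + tp i *\<^sub>R Q) v = t i *\<^sub>R P v + tp i *\<^sub>R Q v" for v
    by (simp add: blinfun.add_left blinfun.scaleR_left)
  have d: "?d = - (t i *\<^sub>R P ?z + tp i *\<^sub>R Q ?z)"
    using primal_step[of i] unfolding T by (simp add: blinfun.add_right scaleR_add_right algebra_simps)
  have PQ: "P (Q v) = 0" "Q (P v) = 0" "Q (Q v) = Q v" for v
    by (simp_all add: Q_apply blinfun.diff_right P_P)
  have Pd: "P ?d = - (t i *\<^sub>R P ?z)"
    unfolding d by (simp only: blinfun.minus_right blinfun.add_right blinfun.scaleR_right PQ P_P) simp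
  have Qd: "Q ?d = - (tp i *\<^sub>R Q ?z)"
    unfolding d by (simp only: blinfun.minus_right blinfun.add_right blinfun.scaleR_right PQ) simp
  have "?z \<bullet> ?u = - (P ?d \<bullet> P ?u / t i + Q ?d \<bullet> Q ?u / tp i)"
    unfolding Pd Qd inner_split[of ?z] using t tp by simp
  moreover have "(p i + Kadj yh) \<bullet> ?u = ?z \<bullet> ?u - K ?u \<bullet> (y i - yh)"
    by (simp add: inner_adjoint inner_diff_right inner_add_left inner_commute[of ?u])
  ultimately have "(p i + Kadj yh) \<bullet> ?u = - (P ?d \<bullet> P ?u / t i + Q ?d \<bullet> Q ?u / tp i) - K ?u \<bullet> (y i - yh)"
    by simp
  then show ?thesis
    using t tp by (simp add: add_divide_distrib diff_divide_distrib power2_eq_square mult.commute)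
qed

text \<open>The denominator of s is t times load, so the dual step length enters the energy through load alone.\<close>
lemma inverse_s: "1 / (s (Suc i) * t (Suc i)) = load (r i) / (1 - \<delta>)" and s_pos: "s (Suc i) > 0"
proof -
  have t: "t i > 0" and w: "w i > 0" by (rule t_pos, rule w_pos)
  have "t i * max 0 (1 - r i) = max 0 (t i - tp i)"
    using t by (simp add: max_mult_distrib_left r_def algebra_simps)
  then have load: "t i * load (r i) = max 0 (t i - tp i) * (norm (K o\<^sub>L P))\<^sup>2 + tp i * (norm K)\<^sup>2"
    using t by (simp add: load_def distrib_left mult.assoc[symmetric]) (simp add: r_def)
  have s: "s (Suc i) = (1 - \<delta>) / (w i * (t i * load (r i)))"
    unfolding load by (simp add: s_Suc)
  show "s (Suc i) > 0"
    unfolding s using t w load_pos[OF r_pos, of i] \<delta>_less_1 by simp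
  show "1 / (s (Suc i) * t (Suc i)) = load (r i) / (1 - \<delta>)"
    unfolding s t_Suc using t w by simp
qed

text \<open>The extrapolation term receives weight \<open>w i / t (Suc i) = 1 / t i\<close>, which
  is the weight of the coupling term in \<open>primal_residual\<close>; this is why the two can be
  merged.\<close>

lemma dual_residual:
  "(q i - K xh) \<bullet> (y (Suc i) - yh) / t (Suc i)
    = K (x (Suc i) - x i) \<bullet> (y (Suc i) - yh) / t i + K (x (Suc i) - xh) \<bullet> (y (Suc i) - yh) / t (Suc i)
      - load (r i) / (1 - \<delta>) * ((y (Suc i) - y i) \<bullet> (y (Suc i) - yh))"
proof -
  let ?v = "y (Suc i) - yh" and ?xb = "w i *\<^sub>R (x (Suc i) - x i) + x (Suc i)"
  have s: "s (Suc i) > 0" and t: "t i > 0" and w: "w i > 0" by (rule s_pos, rule t_pos, rule w_pos)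
  have "s (Suc i) *\<^sub>R q i = s (Suc i) *\<^sub>R K ?xb - (y (Suc i) - y i)"
    using dual_step[of i] by (simp add: algebra_simps)
  then have "(1 / s (Suc i)) *\<^sub>R (s (Suc i) *\<^sub>R q i)
      = (1 / s (Suc i)) *\<^sub>R (s (Suc i) *\<^sub>R K ?xb - (y (Suc i) - y i))" by simp
  then have q: "q i = K ?xb - (1 / s (Suc i)) *\<^sub>R (y (Suc i) - y i)"
    using s by (simp add: scaleR_diff_right)
  have "q i - K xh = w i *\<^sub>R K (x (Suc i) - x i) + K (x (Suc i) - xh) - (1 / s (Suc i)) *\<^sub>R (y (Suc i) - y i)"
    unfolding q by (simp add: blinfun.add_right blinfun.scaleR_right blinfun.diff_right)
  then have "(q i - K xh) \<bullet> ?v / t (Suc i)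
      = w i / t (Suc i) * (K (x (Suc i) - x i) \<bullet> ?v) + K (x (Suc i) - xh) \<bullet> ?v / t (Suc i)
        - 1 / (s (Suc i) * t (Suc i)) * ((y (Suc i) - y i) \<bullet> ?v)"
    by (simp add: inner_add_left inner_diff_left add_divide_distrib diff_divide_distrib)
  moreover have "w i / t (Suc i) = 1 / t i" using w by (simp add: t_Suc)
  ultimately show ?thesis unfolding inverse_s by simp
qed

text \<open>The residual formulas and \<open>inner_diff_self\<close> turn inner products with
  increments into differences of squares. What remains is minus the energy of the increment, which
  may be dropped since it is nonnegative.\<close>

lemma energy_identity:
  "half_sq i (x (Suc i) - xh) (y (Suc i) - yh)
      - K (x (Suc i) - xh) \<bullet> (y (Suc i) - yh) / t (Suc i)
      + (p i + Kadj yh) \<bullet> (x (Suc i) - xh) / t i + (q i - K xh) \<bullet> (y (Suc i) - yh) / t (Suc i)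
    = energy i (x i - xh) (y i - yh) - energy i (x (Suc i) - x i) (y (Suc i) - y i)"
proof -
  define u u0 v v0 where "u = x (Suc i) - xh" and "u0 = x i - xh"
    and "v = y (Suc i) - yh" and "v0 = y i - yh"
  have du: "x (Suc i) - x i = u - u0" and dv: "y (Suc i) - y i = v - v0"
    by (simp_all add: u_def u0_def v_def v0_def)
  have P: "P (u - u0) \<bullet> P u = ((norm (P u))\<^sup>2 + (norm (P (u - u0)))\<^sup>2 - (norm (P u0))\<^sup>2) / 2"
    and Q: "Q (u - u0) \<bullet> Q u = ((norm (Q u))\<^sup>2 + (norm (Q (u - u0)))\<^sup>2 - (norm (Q u0))\<^sup>2) / 2"
    unfolding blinfun.diff_right by (rule inner_diff_self)+
  \<comment> \<open>The primal step pairs with the old dual iterate and the dual step with the new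
    one; the mismatch becomes a product of increments plus the old coupling term.\<close>
  have cross: "K (u - u0) \<bullet> v - K u \<bullet> v0 = K (u - u0) \<bullet> (v - v0) - K u0 \<bullet> v0"
    by (simp add: blinfun.diff_right inner_diff_left inner_diff_right)
  then have cross': "K (u - u0) \<bullet> v / t i = (K (u - u0) \<bullet> (v - v0) - K u0 \<bullet> v0 + K u \<bullet> v0) / t i"
    by (simp add: algebra_simps)
  show ?thesis
    unfolding primal_residual dual_residual
    unfolding u_def[symmetric] u0_def[symmetric] v_def[symmetric] v0_def[symmetric] du dv
    unfolding energy_def half_sq_def P Q inner_diff_self[of v v0] cross'
    by (simp add: add_divide_distrib diff_divide_distrib distrib_left right_diff_distrib)
qed

text \<open>The sequences \<open>a\<close> and \<open>b\<close> are the part of the growth held back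
  for the gap; they are zero when only the iterates are estimated. The other coefficients match the
  increments in \<open>half_sq_Suc\<close> after division by \<open>t i\<close> and
  \<open>t (Suc i)\<close>.\<close>

context
  fixes a b :: "nat \<Rightarrow> real" and Cpsi Cphi :: real
  assumes primal_growth: "\<And>i. (p i + Kadj yh) \<bullet> (x (Suc i) - xh)
      \<ge> a i + \<gamma> * (norm (P (x (Suc i) - xh)))\<^sup>2
        + \<zeta> * (t i * (r (Suc i) - r i)) / 2 * ((norm (Q (x (Suc i) - xh)))\<^sup>2 - Cpsi)"
    and dual_growth: "\<And>i. (q i - K xh) \<bullet> (y (Suc i) - yh)
      \<ge> b i + (norm K)\<^sup>2 / (1 - \<delta>) * (t (Suc i) * (r (Suc i) - r i)) / 2
          * ((norm (y (Suc i) - yh))\<^sup>2 - Cphi)"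
    and C_nonneg: "0 \<le> Cpsi" "0 \<le> Cphi"
begin

text \<open>The squared norms from \<open>half_sq_Suc\<close> cancel against the growth terms, so
  that only the constants \<open>Cpsi\<close> and \<open>Cphi\<close> survive, weighted by the
  increment of \<open>r\<close>.\<close>

lemma energy_step:
  "energy (Suc i) (x (Suc i) - xh) (y (Suc i) - yh) + a i / t i + b i / t (Suc i)
    \<le> energy i (x i - xh) (y i - yh)
      + (r (Suc i) - r i) / 2 * (\<zeta> * Cpsi + (norm K)\<^sup>2 / (1 - \<delta>) * Cphi)"
proof -
  have t: "t i > 0" and t': "t (Suc i) > 0" by (rule t_pos)+
  let ?u = "x (Suc i) - xh" and ?v = "y (Suc i) - yh" and ?d = "r (Suc i) - r i"
  have cancel: "d / 2 * (z * A + k * B) - z * d / 2 * (A - A') - k * d / 2 * (B - B') = d / 2 * (z * A' + k * B')"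
    for d z k A A' B B' :: real by (simp add: field_simps)
  have pr: "(p i + Kadj yh) \<bullet> ?u / t i \<ge>
      a i / t i + \<gamma> / t i * (norm (P ?u))\<^sup>2 + \<zeta> * ?d / 2 * ((norm (Q ?u))\<^sup>2 - Cpsi)"
    using divide_right_mono[OF primal_growth[of i], of "t i"] t by (simp add: add_divide_distrib)
  have du: "(q i - K xh) \<bullet> ?v / t (Suc i) \<ge>
      b i / t (Suc i) + (norm K)\<^sup>2 / (1 - \<delta>) * ?d / 2 * ((norm ?v)\<^sup>2 - Cphi)"
    using divide_right_mono[OF dual_growth[of i], of "t (Suc i)"] t' by (simp add: add_divide_distrib)
  have "energy (Suc i) ?u ?v \<le> half_sq i ?u ?v + \<gamma> / t i * (norm (P ?u))\<^sup>2
      + ?d / 2 * (\<zeta> * (norm (Q ?u))\<^sup>2 + (norm K)\<^sup>2 / (1 - \<delta>) * (norm ?v)\<^sup>2) - K ?u \<bullet> ?v / t (Suc i)"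
    unfolding energy_def using half_sq_Suc[of i ?u ?v] by simp
  moreover have "0 \<le> energy i (x (Suc i) - x i) (y (Suc i) - y i)" by (rule energy_nonneg)
  ultimately have "energy (Suc i) ?u ?v + a i / t i + b i / t (Suc i)
      \<le> energy i (x i - xh) (y i - yh)
        + (?d / 2 * (\<zeta> * (norm (Q ?u))\<^sup>2 + (norm K)\<^sup>2 / (1 - \<delta>) * (norm ?v)\<^sup>2)
          - \<zeta> * ?d / 2 * ((norm (Q ?u))\<^sup>2 - Cpsi)
          - (norm K)\<^sup>2 / (1 - \<delta>) * ?d / 2 * ((norm ?v)\<^sup>2 - Cphi))"
    using pr du energy_identity[of i] by linarith
  also have "?d / 2 * (\<zeta> * (norm (Q ?u))\<^sup>2 + (norm K)\<^sup>2 / (1 - \<delta>) * (norm ?v)\<^sup>2)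
          - \<zeta> * ?d / 2 * ((norm (Q ?u))\<^sup>2 - Cpsi)
          - (norm K)\<^sup>2 / (1 - \<delta>) * ?d / 2 * ((norm ?v)\<^sup>2 - Cphi)
      = ?d / 2 * (\<zeta> * Cpsi + (norm K)\<^sup>2 / (1 - \<delta>) * Cphi)"
    by (rule cancel)
  finally show ?thesis .
qed

lemma energy_sum:
  "energy N (x N - xh) (y N - yh) + (\<Sum>i<N. a i / t i + b i / t (Suc i))
    \<le> energy 0 (x 0 - xh) (y 0 - yh)
      + (r N - r 0) / 2 * (\<zeta> * Cpsi + (norm K)\<^sup>2 / (1 - \<delta>) * Cphi)"
proof (induction N)
  case (Suc N)
  have telescope: "(A - r 0) / 2 * C + (B - A) / 2 * C = (B - r 0) / 2 * C" for A B C
    by (simp add: field_simps)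
  show ?case using Suc energy_step[of N] telescope[of "r N" _ "r (Suc N)"]
    unfolding sum.lessThan_Suc by argo
qed simp

lemma weighted_estimate:
  "\<delta> / 2 * (norm (P (x N - xh)))\<^sup>2 + (t N)\<^sup>2 * (\<Sum>i<N. a i / t i + b i / t (Suc i))
    \<le> (t N)\<^sup>2 * energy 0 (x 0 - xh) (y 0 - yh)
      + t N / 2 * (sqrt \<zeta> * Cpsi + (norm K)\<^sup>2 / (sqrt \<zeta> * (1 - \<delta>)) * Cphi)"
proof -
  let ?S = "\<Sum>i<N. a i / t i + b i / t (Suc i)" and ?E = "energy 0 (x 0 - xh) (y 0 - yh)"
  let ?C = "\<zeta> * Cpsi + (norm K)\<^sup>2 / (1 - \<delta>) * Cphi"
  have t: "t N > 0" by (rule t_pos)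
  have C: "?C \<ge> 0" using \<zeta>_pos C_nonneg \<delta>_less_1 by simp
  have "\<delta> / 2 * (norm (P (x N - xh)))\<^sup>2 / (t N)\<^sup>2 + ?S \<le> ?E + (r N - r 0) / 2 * ?C"
    using energy_sum[of N] energy_ge[of "x N - xh" N "y N - yh"] by linarith
  \<comment> \<open>The positive \<open>r 0\<close> is discarded. Multiplication by
    \<open>t N\<close>^2 then leaves one factor \<open>t N\<close> on the penalties but two on the
    initial energy, hence the two different rates.\<close>
  also have "(r N - r 0) / 2 * ?C \<le> 1 / (sqrt \<zeta> * t N) / 2 * ?C"
    using r_le[of N] r_pos[of 0] C by (intro mult_right_mono divide_right_mono) auto
  finally have "(t N)\<^sup>2 * (\<delta> / 2 * (norm (P (x N - xh)))\<^sup>2 / (t N)\<^sup>2 + ?S)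
      \<le> (t N)\<^sup>2 * (?E + 1 / (sqrt \<zeta> * t N) / 2 * ?C)"
    by (intro mult_left_mono) auto
  also have "(t N)\<^sup>2 * (?E + 1 / (sqrt \<zeta> * t N) / 2 * ?C) = (t N)\<^sup>2 * ?E + t N / 2 * (?C / sqrt \<zeta>)"
    using t \<zeta>_pos by (simp add: field_simps power2_eq_square)
  also have "?C / sqrt \<zeta> = (\<zeta> / sqrt \<zeta>) * Cpsi + (norm K)\<^sup>2 / (sqrt \<zeta> * (1 - \<delta>)) * Cphi"
    by (simp add: add_divide_distrib mult.commute)
  also have "\<dots> = sqrt \<zeta> * Cpsi + (norm K)\<^sup>2 / (sqrt \<zeta> * (1 - \<delta>)) * Cphi"
    using \<zeta>_pos by (simp add: real_div_sqrt)
  finally show ?thesis using t by (simp add: distrib_left)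
qed

text \<open>The initial energy may vanish, so 1 is added to obtain a positive constant.\<close>

lemma rate:
  assumes "N \<ge> 1"
  defines "Ct \<equiv> 1 / (\<gamma> * w 0)"
  shows "\<delta> / 2 * (norm (P (x N - xh)))\<^sup>2 + (t N)\<^sup>2 * (\<Sum>i<N. a i / t i + b i / t (Suc i))
    \<le> (energy 0 (x 0 - xh) (y 0 - yh) + 1) * Ct\<^sup>2 / (real N)\<^sup>2
      + Ct / (2 * real N) * (sqrt \<zeta> * Cpsi + (norm K)\<^sup>2 / (sqrt \<zeta> * (1 - \<delta>)) * Cphi)"
proof -
  let ?E = "energy 0 (x 0 - xh) (y 0 - yh)"
  let ?C = "sqrt \<zeta> * Cpsi + (norm K)\<^sup>2 / (sqrt \<zeta> * (1 - \<delta>)) * Cphi"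
  have C: "?C \<ge> 0" using \<zeta>_pos C_nonneg \<delta>_less_1 by simp
  have t: "0 \<le> t N" "t N \<le> Ct / real N" using t_pos[of N] t_le[OF assms(1)] by (auto simp: Ct_def)
  have "(t N)\<^sup>2 * ?E \<le> (Ct / real N)\<^sup>2 * (?E + 1)"
    using t energy_nonneg[of 0 "x 0 - xh" "y 0 - yh"] by (intro mult_mono power_mono) auto
  also have "\<dots> = (?E + 1) * Ct\<^sup>2 / (real N)\<^sup>2" by (simp add: power_divide)
  finally have 1: "(t N)\<^sup>2 * ?E \<le> (?E + 1) * Ct\<^sup>2 / (real N)\<^sup>2" .
  have "t N / 2 \<le> Ct / (2 * real N)" using t by simp
  then have 2: "t N / 2 * ?C \<le> Ct / (2 * real N) * ?C" using C by (rule mult_right_mono)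
  show ?thesis by (rule order_trans[OF weighted_estimate add_mono[OF 1 2]])
qed

end

end

subsection \<open>The ergodic gap\<close>

text \<open>The products \<open>K xh \<bullet> yh\<close> cancel, and the gap splits into
  \<open>A\<close> for \<open>G\<close> at the primal mean and \<open>B\<close> for
  \<open>Fs\<close> at the dual mean. Each is nonnegative by the optimality of the solution, and
  each is bounded by Jensen's inequality with its own weights.\<close>

lemma ergodic_gap_estimate:
  fixes K :: "'a::{real_inner, complete_space} \<Rightarrow>\<^sub>L 'b::real_inner"
  assumes G: "convex_fun G" "proper_fun G" and Fs: "convex_fun Fs" "proper_fun Fs"
    and sub_G: "- adjoint (blinfun_apply K) yh \<in> subdifferential G xh"
    and sub_Fs: "K xh \<in> subdifferential Fs yh"
    and fin_G: "\<And>i. G (x (Suc i)) \<noteq> \<infinity>" and fin_Fs: "\<And>i. Fs (y (Suc i)) \<noteq> \<infinity>"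
    and t_pos: "\<And>i. t i > 0" and t_dec: "\<And>i. t (Suc i) \<le> t i" and "N \<ge> 1"
    and scale: "\<And>i. tt i = c * t i" "c > 0"
  obtains gap where "ergodic_gap K G Fs xh yh tt x y N = ereal gap" "0 \<le> gap"
    "(\<Sum>j<N. 1 / t j) * gap \<le> (\<Sum>i<N.
        (real_of_ereal (G (x (Suc i))) - real_of_ereal (G xh) + K (x (Suc i) - xh) \<bullet> yh) / t i
      + (real_of_ereal (Fs (y (Suc i))) - real_of_ereal (Fs yh) - K xh \<bullet> (y (Suc i) - yh)) / t (Suc i))"
proof -
  let ?g = "\<lambda>u. real_of_ereal (G u)" and ?f = "\<lambda>v. real_of_ereal (Fs v)"
  define qx qy where "qx = (\<Sum>j<N. 1 / t j)" and "qy = (\<Sum>j<N. 1 / t (Suc j))"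
  define X Y where "X = (1 / qx) *\<^sub>R (\<Sum>i<N. (1 / t i) *\<^sub>R x (Suc i))"
    and "Y = (1 / qy) *\<^sub>R (\<Sum>i<N. (1 / t (Suc i)) *\<^sub>R y (Suc i))"
  have ne: "{..<N} \<noteq> {}" using \<open>N \<ge> 1\<close> by (auto simp: lessThan_empty_iff)
  have q: "qx > 0" "qx \<le> qy"
    unfolding qx_def qy_def using ne t_pos t_dec by (auto intro!: sum_pos sum_mono divide_left_mono)
  then have qy: "qy > 0" by simp
  \<comment> \<open>The common factor \<open>c\<close> cancels in normalised averages, so the
    weights built from \<open>t\<close> may replace those built from \<open>tt\<close>.\<close>
  have rescale: "1 / (c * a) = (1 / c) * (1 / a)" for a by simp
  have cancel: "(1 / ((1 / c) * q)) * (1 / c) = 1 / q" for q using scale(2) by simp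
  have ex: "ergodic_x tt x N = X"
    unfolding ergodic_x_def scale(1) rescale scaleR_scaleR[symmetric] scaleR_sum_right[symmetric]
      sum_distrib_left[symmetric] unfolding scaleR_scaleR cancel X_def qx_def ..
  have ey: "ergodic_y tt y N = Y"
    unfolding ergodic_y_def scale(1) rescale scaleR_scaleR[symmetric] scaleR_sum_right[symmetric]
      sum_distrib_left[symmetric] unfolding scaleR_scaleR cancel Y_def qy_def ..
  have X: "G X \<noteq> \<infinity>" "qx * ?g X \<le> (\<Sum>i<N. 1 / t i * ?g (x (Suc i)))"
    unfolding X_def qx_def using fin_G t_pos \<open>N \<ge> 1\<close>
    by (intro weighted_mean_convex[OF G]; simp)+
  have Y: "Fs Y \<noteq> \<infinity>" "qy * ?f Y \<le> (\<Sum>i<N. 1 / t (Suc i) * ?f (y (Suc i)))"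
    unfolding Y_def qy_def using fin_Fs t_pos \<open>N \<ge> 1\<close>
    by (intro weighted_mean_convex[OF Fs]; simp)+
  define A where "A = ?g X - ?g xh + K (X - xh) \<bullet> yh"
  define B where "B = ?f Y - ?f yh - K xh \<bullet> (Y - yh)"
  have A: "A \<ge> 0" using subgradient_real[OF G(2) sub_G X(1)]
    unfolding A_def inner_adjoint by (simp add: inner_commute)
  have B: "B \<ge> 0" using subgradient_real[OF Fs(2) sub_Fs Y(1)] unfolding B_def by simp
  obtain a b c' d where real: "G X = ereal a" "G xh = ereal b" "Fs Y = ereal c'" "Fs yh = ereal d"
    using X(1) Y(1) subdifferential_finite[OF G(2) sub_G] subdifferential_finite[OF Fs(2) sub_Fs] G(2) Fs(2)
    unfolding proper_fun_def by (metis ereal_cases)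
  have gap: "ergodic_gap K G Fs xh yh tt x y N = ereal (A + B)"
    unfolding ergodic_gap_def ex ey A_def B_def real
    by (simp add: blinfun.diff_right inner_diff_left inner_diff_right inner_commute)
  have KX: "qx *\<^sub>R (K X - K xh) = (\<Sum>i<N. (1 / t i) *\<^sub>R K (x (Suc i) - xh))"
    using q unfolding X_def
    by (simp add: blinfun.scaleR_right blinfun.sum_right blinfun.diff_right scaleR_diff_right sum_subtractf
        scaleR_sum_left[symmetric] qx_def)
  have YY: "qy *\<^sub>R (Y - yh) = (\<Sum>i<N. (1 / t (Suc i)) *\<^sub>R (y (Suc i) - yh))"
    using qy unfolding Y_def
    by (simp add: scaleR_diff_right sum_subtractf scaleR_sum_left[symmetric] qy_def)
  have "qx * A = qx * ?g X - qx * ?g xh + (qx *\<^sub>R (K X - K xh)) \<bullet> yh"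
    by (simp add: A_def algebra_simps blinfun.diff_right)
  also have "\<dots> \<le> (\<Sum>i<N. 1 / t i * ?g (x (Suc i))) - (\<Sum>i<N. 1 / t i * ?g xh)
      + (\<Sum>i<N. ((1 / t i) *\<^sub>R K (x (Suc i) - xh)) \<bullet> yh)"
    unfolding KX sum_distrib_right[symmetric] qx_def[symmetric] inner_sum_left using X(2) by simp
  also have "\<dots> = (\<Sum>i<N. (?g (x (Suc i)) - ?g xh + K (x (Suc i) - xh) \<bullet> yh) / t i)"
    by (simp add: sum_subtractf[symmetric] sum.distrib[symmetric] add_divide_distrib diff_divide_distrib)
  finally have 1: "qx * A \<le> \<dots>" .
  have "qy * B = qy * ?f Y - qy * ?f yh - K xh \<bullet> (qy *\<^sub>R (Y - yh))"
    by (simp add: B_def algebra_simps)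
  also have "\<dots> \<le> (\<Sum>i<N. 1 / t (Suc i) * ?f (y (Suc i))) - (\<Sum>i<N. 1 / t (Suc i) * ?f yh)
      - (\<Sum>i<N. K xh \<bullet> ((1 / t (Suc i)) *\<^sub>R (y (Suc i) - yh)))"
    unfolding YY sum_distrib_right[symmetric] qy_def[symmetric] inner_sum_right using Y(2) by simp
  also have "\<dots> = (\<Sum>i<N. (?f (y (Suc i)) - ?f yh - K xh \<bullet> (y (Suc i) - yh)) / t (Suc i))"
    by (simp add: sum_subtractf[symmetric] diff_divide_distrib)
  finally have 2: "qy * B \<le> \<dots>" .
  \<comment> \<open>Since \<open>t\<close> decreases, \<open>qx \<le> qy\<close>; with
    \<open>B \<ge> 0\<close> both parts can share the smaller total weight.\<close>
  have "qx * (A + B) \<le> qx * A + qy * B"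
    using q B by (simp add: distrib_left mult_right_mono)
  with 1 2 show ?thesis
    using gap A B by (intro that[of "A + B"]) (simp_all add: sum.distrib qx_def)
qed

subsection \<open>Convergence rates\<close>

locale pdhgm_partial_strong = pdhgm_iterates \<gamma> \<zeta> w wp t tp K P \<delta> s x p y q xh yh
  for \<gamma> \<zeta> :: real and w wp t tp :: "nat \<Rightarrow> real"
    and K :: "'a::{real_inner, complete_space} \<Rightarrow>\<^sub>L 'b::real_inner" and P :: "'a \<Rightarrow>\<^sub>L 'a"
    and \<delta> :: real and s :: "nat \<Rightarrow> real" and x p :: "nat \<Rightarrow> 'a" and y q :: "nat \<Rightarrow> 'b"
    and xh :: 'a and yh :: 'b +
  fixes G :: "'a \<Rightarrow> ereal" and Fs :: "'b \<Rightarrow> ereal" and gbar gpbar rbar Cphi Cpsi lam :: real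
  assumes G_convex: "convex_fun G" and G_proper: "proper_fun G"
    and Fs_convex: "convex_fun Fs" and Fs_proper: "proper_fun Fs"
    and p_sub: "\<And>i. p i \<in> subdifferential G (x (Suc i))"
    and q_sub: "\<And>i. q i \<in> subdifferential Fs (y (Suc i))"
    and xh_sub: "- adjoint (blinfun_apply K) yh \<in> subdifferential G xh"
    and yh_sub: "K xh \<in> subdifferential Fs yh"
    and gpbar_pos: "gpbar > 0" and rbar_pos: "rbar > 0" and Cphi_pos: "Cphi > 0" and Cpsi_pos: "Cpsi > 0"
    and G_strong: "\<And>u u' p gp. p \<in> subdifferential G u \<Longrightarrow> 0 \<le> gp \<Longrightarrow> gp \<le> gpbar \<Longrightarrow>
           G u' - G u \<ge> ereal (p \<bullet> (u' - u) + gbar / 2 * (norm (P (u' - u)))\<^sup>2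
             + gp / 2 * ((norm ((id_blinfun - P) (u' - u)))\<^sup>2 - Cpsi))"
    and Fs_strong: "\<And>v v' q r. q \<in> subdifferential Fs v \<Longrightarrow> 0 \<le> r \<Longrightarrow> r \<le> rbar \<Longrightarrow>
           Fs v' - Fs v \<ge> ereal (q \<bullet> (v' - v) + r / 2 * ((norm (v' - v))\<^sup>2 - Cphi))"
    and lam_pos: "lam > 0" and \<gamma>_le: "\<gamma> \<le> lam * gbar"
    and t0_le: "t 0 \<le> lam\<^sup>2 / (2 * \<gamma>) * min (gpbar\<^sup>2 / \<zeta>) (rbar\<^sup>2 * \<zeta> * (1 - \<delta>)\<^sup>2 / (norm K) ^ 4)"
begin

section \<open>Admissible moduli and growth inequalities\<close>

abbreviation g :: "'a \<Rightarrow> real" where "g u \<equiv> real_of_ereal (G u)"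
abbreviation f :: "'b \<Rightarrow> real" where "f v \<equiv> real_of_ereal (Fs v)"

lemma G_finite: "G (x (Suc i)) \<noteq> \<infinity>" "G xh \<noteq> \<infinity>"
  by (rule subdifferential_finite[OF G_proper], rule p_sub xh_sub)+

lemma Fs_finite: "Fs (y (Suc i)) \<noteq> \<infinity>" "Fs yh \<noteq> \<infinity>"
  by (rule subdifferential_finite[OF Fs_proper], rule q_sub yh_sub)+

text \<open>One bound serves both entries of the minimum restricting \<open>t 0\<close>:
  \<open>k = \<zeta>\<close> with \<open>M = gpbar\<close>, and
  \<open>k = (norm K)^2 / (1 - \<delta>)\<close> with \<open>M = rbar\<close>.\<close>

lemma r_increment_bound:
  assumes "2 * \<gamma> * t 0 \<le> lam\<^sup>2 * (M\<^sup>2 * \<zeta> / k\<^sup>2)" and "k > 0" and "M > 0"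
  shows "k * (t i * (r (Suc i) - r i)) \<le> lam * M"
proof (rule power2_le_imp_le)
  have "2 * \<gamma> * t i \<le> 2 * \<gamma> * t 0" using t_le_t0[of i] \<gamma>_pos by simp
  then have "\<zeta> * (t i * (r (Suc i) - r i))\<^sup>2 \<le> lam\<^sup>2 * (M\<^sup>2 * \<zeta> / k\<^sup>2)"
    using r_increment_sq[of i] assms(1) by linarith
  then have "\<zeta> * (t i * (r (Suc i) - r i))\<^sup>2 \<le> \<zeta> * (lam\<^sup>2 * M\<^sup>2 / k\<^sup>2)" by (simp add: mult_ac)
  then have "(t i * (r (Suc i) - r i))\<^sup>2 \<le> lam\<^sup>2 * M\<^sup>2 / k\<^sup>2"
    using \<zeta>_pos by (rule mult_left_le_imp_le)
  then show "(k * (t i * (r (Suc i) - r i)))\<^sup>2 \<le> (lam * M)\<^sup>2"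
    unfolding power_mult_distrib[of k] power_mult_distrib[of lam] using assms(2)
    by (simp add: pos_le_divide_eq mult.commute)
qed (use lam_pos assms(3) in simp)

text \<open>Chosen so that \<open>lam\<close> times \<open>gp i\<close> is the coefficient required
  by \<open>primal_growth\<close>; \<open>rho\<close> plays the same role for
  \<open>dual_growth\<close>, with \<open>t (Suc i)\<close> because the dual residual is divided by
  it.\<close>

definition gp :: "nat \<Rightarrow> real" where
  "gp i = \<zeta> * (t i * (r (Suc i) - r i)) / (2 * lam)"

definition rho :: "nat \<Rightarrow> real" where
  "rho i = (norm K)\<^sup>2 / (1 - \<delta>) * (t (Suc i) * (r (Suc i) - r i)) / (2 * lam)"

lemma gp_bounds: "0 \<le> gp i" "gp i \<le> gpbar"
proof -
  show "0 \<le> gp i"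
    using r_mono[of i] t_pos[of i] \<zeta>_pos lam_pos by (simp add: gp_def)
  have "2 * \<gamma> * t 0 \<le> lam\<^sup>2 * min (gpbar\<^sup>2 / \<zeta>) (rbar\<^sup>2 * \<zeta> * (1 - \<delta>)\<^sup>2 / (norm K) ^ 4)"
    using t0_le \<gamma>_pos by (simp add: field_simps)
  also have "\<dots> \<le> lam\<^sup>2 * (gpbar\<^sup>2 / \<zeta>)" by (intro mult_left_mono) auto
  also have "\<dots> = lam\<^sup>2 * (gpbar\<^sup>2 * \<zeta> / \<zeta>\<^sup>2)" using \<zeta>_pos by (simp add: power2_eq_square)
  finally have "\<zeta> * (t i * (r (Suc i) - r i)) \<le> lam * gpbar"
    using \<zeta>_pos gpbar_pos by (rule r_increment_bound)
  also have "\<dots> \<le> gpbar * (2 * lam)" using lam_pos gpbar_pos by simp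
  finally show "gp i \<le> gpbar"
    unfolding gp_def by (rule mult_imp_div_pos_le[rotated]) (use lam_pos in simp)
qed

lemma rho_bounds: "0 \<le> rho i" "rho i \<le> rbar"
proof -
  let ?k = "(norm K)\<^sup>2 / (1 - \<delta>)"
  have k: "?k > 0" using K_nonzero \<delta>_less_1 by simp
  show "0 \<le> rho i"
    unfolding rho_def using r_mono[of i] t_pos[of "Suc i"] lam_pos
    by (intro divide_nonneg_pos mult_nonneg_nonneg less_imp_le[OF k]) auto
  have "2 * \<gamma> * t 0 \<le> lam\<^sup>2 * min (gpbar\<^sup>2 / \<zeta>) (rbar\<^sup>2 * \<zeta> * (1 - \<delta>)\<^sup>2 / (norm K) ^ 4)"
    using t0_le \<gamma>_pos by (simp add: field_simps)
  also have "\<dots> \<le> lam\<^sup>2 * (rbar\<^sup>2 * \<zeta> * (1 - \<delta>)\<^sup>2 / (norm K) ^ 4)"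
    by (intro mult_left_mono) auto
  also have "\<dots> = lam\<^sup>2 * (rbar\<^sup>2 * \<zeta> / ?k\<^sup>2)" by (simp add: power_divide)
  finally have le: "?k * (t i * (r (Suc i) - r i)) \<le> lam * rbar"
    using k rbar_pos by (rule r_increment_bound)
  have "?k * (t (Suc i) * (r (Suc i) - r i)) \<le> ?k * (t i * (r (Suc i) - r i))"
    using k r_mono[of i] t_Suc_le[of i] by (intro mult_left_mono mult_right_mono) auto
  also note le
  also have "lam * rbar \<le> rbar * (2 * lam)" using lam_pos rbar_pos by simp
  finally show "rho i \<le> rbar"
    unfolding rho_def by (rule mult_imp_div_pos_le[rotated]) (use lam_pos in simp)
qed

lemma G_growth_iterate:
  "p i \<bullet> (x (Suc i) - xh) \<ge> g (x (Suc i)) - g xh + gbar / 2 * (norm (P (x (Suc i) - xh)))\<^sup>2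
      + gp i / 2 * ((norm (Q (x (Suc i) - xh)))\<^sup>2 - Cpsi)"
  using real_of_ereal_diff_ge[OF G_proper G_finite(1) G_finite(2) G_strong[OF p_sub gp_bounds], of i i]
  unfolding minus_diff_eq[of "x (Suc i)" xh, symmetric] blinfun.minus_right norm_minus_cancel
  by (simp add: inner_diff_right)

text \<open>The counterpart of \<open>G_growth_iterate\<close> with the roles of the two points
  exchanged: adding both cancels the function values and doubles the growth.\<close>

lemma G_growth_solution:
  "g (x (Suc i)) - g xh + K (x (Suc i) - xh) \<bullet> yh \<ge> gbar / 2 * (norm (P (x (Suc i) - xh)))\<^sup>2
      + gp i / 2 * ((norm (Q (x (Suc i) - xh)))\<^sup>2 - Cpsi)"
  using real_of_ereal_diff_ge[OF G_proper G_finite(2) G_finite(1) G_strong[OF xh_sub gp_bounds], of i i]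
  unfolding inner_adjoint by (simp add: inner_commute)

lemma Fs_growth_iterate:
  "q i \<bullet> (y (Suc i) - yh) \<ge> f (y (Suc i)) - f yh + rho i / 2 * ((norm (y (Suc i) - yh))\<^sup>2 - Cphi)"
  using real_of_ereal_diff_ge[OF Fs_proper Fs_finite(1) Fs_finite(2) Fs_strong[OF q_sub rho_bounds], of i i]
  unfolding minus_diff_eq[of "y (Suc i)" yh, symmetric] norm_minus_cancel by (simp add: inner_diff_right)

lemma Fs_growth_solution:
  "f (y (Suc i)) - f yh - K xh \<bullet> (y (Suc i) - yh) \<ge> rho i / 2 * ((norm (y (Suc i) - yh))\<^sup>2 - Cphi)"
  using real_of_ereal_diff_ge[OF Fs_proper Fs_finite(2) Fs_finite(1) Fs_strong[OF yh_sub rho_bounds], of i i]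
  by simp

text \<open>The factor \<open>lam\<close> counts growth inequalities: 1/2 corresponds to one per
  function, 1 to two. The bound on \<gamma> lets the growth along \<open>P\<close> cover the term
  demanded by \<open>rate\<close>.\<close>

lemma rate_of_growth:
  assumes "N \<ge> 1"
    and a: "\<And>i. p i \<bullet> (x (Suc i) - xh) + K (x (Suc i) - xh) \<bullet> yh
        \<ge> a i + lam * gbar * (norm (P (x (Suc i) - xh)))\<^sup>2
          + lam * gp i * ((norm (Q (x (Suc i) - xh)))\<^sup>2 - Cpsi)"
    and b: "\<And>i. q i \<bullet> (y (Suc i) - yh) - K xh \<bullet> (y (Suc i) - yh)
        \<ge> b i + lam * rho i * ((norm (y (Suc i) - yh))\<^sup>2 - Cphi)"
  shows "\<delta> / 2 * (norm (P (x N - xh)))\<^sup>2 + (t N)\<^sup>2 * (\<Sum>i<N. a i / t i + b i / t (Suc i))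
    \<le> (energy 0 (x 0 - xh) (y 0 - yh) + 1) * (1 / (\<gamma> * w 0))\<^sup>2 / (real N)\<^sup>2
      + 1 / (\<gamma> * w 0) / (2 * real N) * (sqrt \<zeta> * Cpsi + (norm K)\<^sup>2 / (sqrt \<zeta> * (1 - \<delta>)) * Cphi)"
proof (rule rate[OF _ _ _ _ \<open>N \<ge> 1\<close>])
  have half: "lam * gp i = \<zeta> * (t i * (r (Suc i) - r i)) / 2"
      "lam * rho i = (norm K)\<^sup>2 / (1 - \<delta>) * (t (Suc i) * (r (Suc i) - r i)) / 2" for i
    using lam_pos by (simp_all add: gp_def rho_def)
  show "(p i + Kadj yh) \<bullet> (x (Suc i) - xh) \<ge> a i + \<gamma> * (norm (P (x (Suc i) - xh)))\<^sup>2
      + \<zeta> * (t i * (r (Suc i) - r i)) / 2 * ((norm (Q (x (Suc i) - xh)))\<^sup>2 - Cpsi)" for i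
  proof -
    have "(p i + Kadj yh) \<bullet> (x (Suc i) - xh) = p i \<bullet> (x (Suc i) - xh) + K (x (Suc i) - xh) \<bullet> yh"
      unfolding inner_add_left inner_adjoint by (simp add: inner_commute)
    moreover have "\<gamma> * (norm (P (x (Suc i) - xh)))\<^sup>2 \<le> lam * gbar * (norm (P (x (Suc i) - xh)))\<^sup>2"
      using \<gamma>_le by (intro mult_right_mono) auto
    ultimately show ?thesis using a[of i] unfolding half by linarith
  qed
  show "(q i - K xh) \<bullet> (y (Suc i) - yh)
      \<ge> b i + (norm K)\<^sup>2 / (1 - \<delta>) * (t (Suc i) * (r (Suc i) - r i)) / 2
        * ((norm (y (Suc i) - yh))\<^sup>2 - Cphi)" for i
    using b[of i] unfolding half inner_diff_left by linarith
qed (use Cpsi_pos Cphi_pos in auto)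

lemma rate_constants_pos: "energy 0 (x 0 - xh) (y 0 - yh) + 1 > 0" "1 / (\<gamma> * w 0) > 0"
  using energy_nonneg[of 0 "x 0 - xh" "y 0 - yh"] \<gamma>_pos w_pos[of 0] by auto

text \<open>One growth inequality per function, taken at the iterate, leaves the differences
  \<open>?a\<close> and \<open>?b\<close> available; these are the summands that dominate the
  gap.\<close>

lemma gap_rate_pointwise:
  assumes lam: "lam = 1/2" and N: "N \<ge> 1" and tt: "\<And>i. tt i = c * t i" and c: "c > 0"
  shows "ereal (\<delta> / 2 * (norm (P (x N - xh)))\<^sup>2)
      + ereal (1 / (1 / t 0 + 2 * \<gamma>)) * ergodic_gap K G Fs xh yh tt x y N
    \<le> ereal ((energy 0 (x 0 - xh) (y 0 - yh) + 1) * (1 / (\<gamma> * w 0))\<^sup>2 / (real N)\<^sup>2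
      + 1 / (\<gamma> * w 0) / (2 * real N) * (sqrt \<zeta> * Cpsi + (norm K)\<^sup>2 / (sqrt \<zeta> * (1 - \<delta>)) * Cphi))"
proof -
  let ?a = "\<lambda>i. g (x (Suc i)) - g xh + K (x (Suc i) - xh) \<bullet> yh"
    and ?b = "\<lambda>i. f (y (Suc i)) - f yh - K xh \<bullet> (y (Suc i) - yh)"
  obtain gap where gap: "ergodic_gap K G Fs xh yh tt x y N = ereal gap" "0 \<le> gap"
    and gap_le: "(\<Sum>j<N. 1 / t j) * gap \<le> (\<Sum>i<N. ?a i / t i + ?b i / t (Suc i))"
    using ergodic_gap_estimate[where x = x and y = y and t = t and tt = tt,
        OF G_convex G_proper Fs_convex Fs_proper xh_sub yh_sub G_finite(1) Fs_finite(1) t_pos t_Suc_le N tt c]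
    by blast
  have "1 / (1 / t 0 + 2 * \<gamma>) * gap \<le> ((t N)\<^sup>2 * (\<Sum>j<N. 1 / t j)) * gap"
    using weight_sum_ge[OF N] gap(2) by (rule mult_right_mono)
  also have "\<dots> \<le> (t N)\<^sup>2 * (\<Sum>i<N. ?a i / t i + ?b i / t (Suc i))"
    unfolding mult.assoc using gap_le by (rule mult_left_mono) simp
  finally have "\<delta> / 2 * (norm (P (x N - xh)))\<^sup>2 + 1 / (1 / t 0 + 2 * \<gamma>) * gap
      \<le> \<delta> / 2 * (norm (P (x N - xh)))\<^sup>2 + (t N)\<^sup>2 * (\<Sum>i<N. ?a i / t i + ?b i / t (Suc i))"
    by simp
  also note rate_of_growth[OF N, of ?a ?b]
  finally show ?thesis
    using G_growth_iterate Fs_growth_iterate unfolding gap(1) lam by (simp add: algebra_simps)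
qed

lemma gap_rate:
  assumes "lam = 1/2" and "tt 0 > 0" and "\<And>i. tt (Suc i) = tt i * w i"
  shows "\<exists>C0>0. \<exists>Ctau>0. \<forall>N\<ge>1.
            ereal (\<delta> / 2 * (norm (P (x N - xh)))\<^sup>2)
              + ereal (1 / (1 / t 0 + 2 * \<gamma>)) * ergodic_gap K G Fs xh yh tt x y N
            \<le> ereal (C0 * Ctau\<^sup>2 / (real N)\<^sup>2
                + Ctau / (2 * real N)
                  * (sqrt \<zeta> * Cpsi + (norm K)\<^sup>2 / (sqrt \<zeta> * (1 - \<delta>)) * Cphi))"
proof -
  \<comment> \<open>Both sequences are multiplied by \<open>w i\<close> at each step, so their
    quotient is constant.\<close>
  have tt: "tt i = tt 0 / t 0 * t i" for i
    by (induction i) (use t0_pos in \<open>simp_all add: assms(3) t_Suc\<close>)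
  have "tt 0 / t 0 > 0" using assms(2) t0_pos by simp
  then show ?thesis
    using rate_constants_pos gap_rate_pointwise[OF assms(1) _ tt] by blast
qed

text \<open>The growth inequalities at the iterate and at the solution are summed, so no function
  values remain and \<open>a\<close> and \<open>b\<close> are zero.\<close>

lemma iterate_rate:
  assumes lam: "lam = 1"
  shows "\<exists>C0>0. \<exists>Ctau>0. \<forall>N\<ge>1.
            \<delta> / 2 * (norm (P (x N - xh)))\<^sup>2
            \<le> C0 * Ctau\<^sup>2 / (real N)\<^sup>2
                + Ctau / (2 * real N)
                  * (sqrt \<zeta> * Cpsi + (norm K)\<^sup>2 / (sqrt \<zeta> * (1 - \<delta>)) * Cphi)"
proof -
  have "p i \<bullet> (x (Suc i) - xh) + K (x (Suc i) - xh) \<bullet> yh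
      \<ge> 0 + lam * gbar * (norm (P (x (Suc i) - xh)))\<^sup>2
        + lam * gp i * ((norm (Q (x (Suc i) - xh)))\<^sup>2 - Cpsi)" for i
    using add_mono[OF G_growth_iterate G_growth_solution, of i i] unfolding lam by (simp add: field_simps)
  moreover have "q i \<bullet> (y (Suc i) - yh) - K xh \<bullet> (y (Suc i) - yh)
      \<ge> 0 + lam * rho i * ((norm (y (Suc i) - yh))\<^sup>2 - Cphi)" for i
    using add_mono[OF Fs_growth_iterate Fs_growth_solution, of i i] unfolding lam by (simp add: field_simps)
  ultimately have "\<delta> / 2 * (norm (P (x N - xh)))\<^sup>2
      \<le> (energy 0 (x 0 - xh) (y 0 - yh) + 1) * (1 / (\<gamma> * w 0))\<^sup>2 / (real N)\<^sup>2
        + 1 / (\<gamma> * w 0) / (2 * real N) * (sqrt \<zeta> * Cpsi + (norm K)\<^sup>2 / (sqrt \<zeta> * (1 - \<delta>)) * Cphi)"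
    if "N \<ge> 1" for N
    using rate_of_growth[OF that, of "\<lambda>_. 0" "\<lambda>_. 0"] by simp
  then show ?thesis using rate_constants_pos by blast
qed

end

section \<open>From the algorithm to step rules and subgradients\<close>

lemma pdhgm_iterationD:
  assumes "pdhgm_iteration K P G Fs \<gamma> \<delta> \<zeta> w wp t tp s x y"
  shows "w i = 1 / sqrt (1 + 2 * \<gamma> * t i)"
    and "wp i = 1/2 * ((1 - 1 / (\<zeta> * (tp i)\<^sup>2)) * w i
              + sqrt ((1 - 1 / (\<zeta> * (tp i)\<^sup>2))\<^sup>2 * (w i)\<^sup>2 + 4 / (\<zeta> * (tp i)\<^sup>2)))"
    and "t (Suc i) = t i * w i" and "tp (Suc i) = tp i * wp i"
    and "s (Suc i) = (1 / w i) * (1 - \<delta>)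
              / (max 0 (t i - tp i) * (norm (K o\<^sub>L P))\<^sup>2 + tp i * (norm K)\<^sup>2)"
  using assms unfolding pdhgm_iteration_def by blast+

lemma pdhgm_iterationE:
  assumes "pdhgm_iteration K P G Fs \<gamma> \<delta> \<zeta> w wp t tp s x y"
  obtains p q where "\<And>i. p i \<in> subdifferential G (x (Suc i))"
    "\<And>i. x i - (t i *\<^sub>R P + tp i *\<^sub>R (id_blinfun - P)) (adjoint (blinfun_apply K) (y i))
      = x (Suc i) + (t i *\<^sub>R P + tp i *\<^sub>R (id_blinfun - P)) (p i)"
    "\<And>i. q i \<in> subdifferential Fs (y (Suc i))"
    "\<And>i. y i + s (Suc i) *\<^sub>R K (w i *\<^sub>R (x (Suc i) - x i) + x (Suc i)) = y (Suc i) + s (Suc i) *\<^sub>R q i"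
proof -
  note iter = assms[unfolded pdhgm_iteration_def Let_def]
  let ?T = "\<lambda>i. t i *\<^sub>R P + tp i *\<^sub>R (id_blinfun - P)"
  have "\<forall>i. \<exists>p. p \<in> subdifferential G (x (Suc i)) \<and>
      x i - ?T i (adjoint (blinfun_apply K) (y i)) = x (Suc i) + ?T i p"
    using iter unfolding resolvent_def by blast
  moreover have "\<forall>i. \<exists>q. q \<in> subdifferential Fs (y (Suc i)) \<and>
      y i + s (Suc i) *\<^sub>R K (w i *\<^sub>R (x (Suc i) - x i) + x (Suc i)) = y (Suc i) + s (Suc i) *\<^sub>R q"
    using iter unfolding resolvent_def by (fastforce simp: blinfun.scaleR_left)
  ultimately show thesis using that by metis
qed

theorem theorem4p1:
  fixes K :: "'a::{real_inner, complete_space} \<Rightarrow>\<^sub>L 'b::{real_inner, complete_space}"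
    and P :: "'a \<Rightarrow>\<^sub>L 'a"
    and G :: "'a \<Rightarrow> ereal" and Fs :: "'b \<Rightarrow> ereal"
    and gbar gpbar rbar Cphi Cpsi lam \<gamma> \<delta> \<zeta> :: real
    and xh :: 'a and yh :: 'b
    and w wp t tp s tt :: "nat \<Rightarrow> real"
    and x :: "nat \<Rightarrow> 'a" and y :: "nat \<Rightarrow> 'b"
  assumes "K \<noteq> 0"
    and "convex_fun G" and "proper_fun G" and "lsc_fun G"
    and "convex_fun Fs" and "proper_fun Fs" and "lsc_fun Fs"
    and "P o\<^sub>L P = P" and "adjoint (blinfun_apply P) = blinfun_apply P"
    and "gbar > 0" and "gpbar > 0" and "rbar > 0" and "Cphi > 0" and "Cpsi > 0"
    and "\<And>u u' p gp. p \<in> subdifferential G u \<Longrightarrow> 0 \<le> gp \<Longrightarrow> gp \<le> gpbar \<Longrightarrow>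
           G u' - G u \<ge> ereal (p \<bullet> (u' - u) + gbar / 2 * (norm (P (u' - u)))\<^sup>2
             + gp / 2 * ((norm ((id_blinfun - P) (u' - u)))\<^sup>2 - Cpsi))"
    and "\<And>v v' q r. q \<in> subdifferential Fs v \<Longrightarrow> 0 \<le> r \<Longrightarrow> r \<le> rbar \<Longrightarrow>
           Fs v' - Fs v \<ge> ereal (q \<bullet> (v' - v) + r / 2 * ((norm (v' - v))\<^sup>2 - Cphi))"
    and "- adjoint (blinfun_apply K) yh \<in> subdifferential G xh"
    and "K xh \<in> subdifferential Fs yh"
    and "0 < \<gamma>" and "\<gamma> \<le> lam * gbar"
    and "t 0 > 0" and "tp 0 > 0" and "0 < \<delta>" and "\<delta> < 1"
    and "0 < \<zeta>" and "\<zeta> \<le> 1 / (tp 0)\<^sup>2"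
    and "t 0 \<le> lam\<^sup>2 / (2 * \<gamma>) * min (gpbar\<^sup>2 / \<zeta>) (rbar\<^sup>2 * \<zeta> * (1 - \<delta>)\<^sup>2 / (norm K) ^ 4)"
    and "pdhgm_iteration K P G Fs \<gamma> \<delta> \<zeta> w wp t tp s x y"
    and "tt 0 > 0" and "\<And>i. tt (Suc i) = tt i * w i"
  shows "(lam = 1/2 \<longrightarrow> (\<exists>C0>0. \<exists>Ctau>0. \<forall>N\<ge>1.
            ereal (\<delta> / 2 * (norm (P (x N - xh)))\<^sup>2)
              + ereal (1 / (1 / t 0 + 2 * \<gamma>)) * ergodic_gap K G Fs xh yh tt x y N
            \<le> ereal (C0 * Ctau\<^sup>2 / (real N)\<^sup>2
                + Ctau / (2 * real N)
                  * (sqrt \<zeta> * Cpsi + (norm K)\<^sup>2 / (sqrt \<zeta> * (1 - \<delta>)) * Cphi))))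
       \<and> (lam = 1 \<longrightarrow> (\<exists>C0>0. \<exists>Ctau>0. \<forall>N\<ge>1.
            \<delta> / 2 * (norm (P (x N - xh)))\<^sup>2
            \<le> C0 * Ctau\<^sup>2 / (real N)\<^sup>2
                + Ctau / (2 * real N)
                  * (sqrt \<zeta> * Cpsi + (norm K)\<^sup>2 / (sqrt \<zeta> * (1 - \<delta>)) * Cphi)))"
proof -
  obtain p q where pq: "\<And>i. p i \<in> subdifferential G (x (Suc i))"
    "\<And>i. x i - (t i *\<^sub>R P + tp i *\<^sub>R (id_blinfun - P)) (adjoint (blinfun_apply K) (y i))
      = x (Suc i) + (t i *\<^sub>R P + tp i *\<^sub>R (id_blinfun - P)) (p i)"
    "\<And>i. q i \<in> subdifferential Fs (y (Suc i))"
    "\<And>i. y i + s (Suc i) *\<^sub>R K (w i *\<^sub>R (x (Suc i) - x i) + x (Suc i)) = y (Suc i) + s (Suc i) *\<^sub>R q i"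
    using pdhgm_iterationE[OF assms(28)] by blast
  \<comment> \<open>Positivity of \<open>lam\<close> follows from 0 < \<gamma> \<le>
    \<open>lam\<close> \<open>gbar\<close> and \<open>gbar > 0\<close>, so one interpretation covers
    both cases.\<close>
  have lam: "lam > 0" using less_le_trans[OF assms(19,20)] assms(10) by (simp add: zero_less_mult_iff)
  interpret pdhgm_partial_strong \<gamma> \<zeta> w wp t tp K P \<delta> s x p y q xh yh G Fs gbar gpbar rbar Cphi Cpsi lam
    by unfold_locales (fact lam assms pq pdhgm_iterationD[OF assms(28)])+
  show ?thesis using gap_rate[OF _ assms(29,30)] iterate_rate by blast
qed

end
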